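(* Let $p$ be a complex polynomial of degree $n\ge 2$ with all its zeros in the closed unit disk $\{z\in\mathbb C: |z|\le 1\}$, and let $\zeta_1,\ldots,\zeta_{n-1}$ be its critical points (the zeros of $p'$), counted with multiplicity. Then for every zero $a$ of $p$ and every real $\lambda\ge 2$, $$\sum_{j=1}^{n-1}\frac{1}{|a-\zeta_j|^\lambda}\ge n-1 .$$ For each such $\lambda$, equality holds (at the zero $a$) if and only if $p(z)=c(z^n-\omega)$ for some $c\in\mathbb C\setminus\{0\}$ and $\omega\in\mathbb C$ with $|\omega|=1$.
   Context: A term with zero denominator in a reciprocal-distance sum is interpreted as $+\infty$. *)

theory Defs
  imports
    "HOL-Analysis.Analysis"
    "HOL-Computational_Algebra.Computational_Algebra"
begin

text \<open>
  A reciprocal power of a distance takes values in the extended nonnegative reals: for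
  \<open>a = z\<close> (and positive exponent) the denominator is 0, and the term is \<open>\<infinity>\<close>
  by the convention \<open>1 / 0 = \<infinity>\<close> of \<open>ennreal\<close>.
\<close>

definition recip_dist_powr :: "real \<Rightarrow> complex \<Rightarrow> complex \<Rightarrow> ennreal" where
  "recip_dist_powr s a z = 1 / ennreal (cmod (a - z) powr s)"

text \<open>The sum over the critical points of \<open>p\<close> runs over a multiset, so it respects multiplicities.\<close>

definition crit_recip_sum :: "real \<Rightarrow> complex poly \<Rightarrow> complex \<Rightarrow> ennreal" where
  "crit_recip_sum s p a = (\<Sum>\<zeta>\<in>#proots (pderiv p). recip_dist_powr s a \<zeta>)"

lemma recip_dist_powr_self: "recip_dist_powr s a a = \<infinity>"
  by (simp add: recip_dist_powr_def ennreal_divide_zero)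

lemma recip_dist_powr_neq:
  "a \<noteq> z \<Longrightarrow> recip_dist_powr s a z = ennreal (1 / cmod (a - z) powr s)"
  by (simp add: recip_dist_powr_def divide_ennreal flip: ennreal_1)

end

theory Submission
  imports Defs
begin

text \<open>
  Normalise the zero to \<open>a \<in> [0, 1]\<close> and put \<open>w\<^sub>j = 1 / (\<zeta>\<^sub>j - a)\<close>, \<open>u\<^sub>k = 1 / (z\<^sub>k - a)\<close>,
  where the \<open>z\<^sub>k\<close> are the other zeros and \<open>N = n - 1\<close>. By Bernoulli's inequality it is enough to
  treat \<open>\<lambda> = 2\<close>, that is, to bound the mean \<open>W\<close> of \<open>\<bar>w\<^sub>j\<bar>\<^sup>2\<close> from below by 1. For \<open>a = 1\<close> this holds
  because \<open>Re u\<^sub>k \<le> -1/2\<close> and \<open>\<Sum> w\<^sub>j = 2 \<Sum> u\<^sub>k\<close>.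

  For \<open>a < 1\<close> assume \<open>W \<le> 1\<close> and let \<open>v\<close> be the mean of the \<open>w\<^sub>j\<close>, \<open>m = - Re v\<close> and
  \<open>\<delta> = 1 - a\<^sup>2\<close>. Comparing \<open>p'\<close> with the product of its factors at \<open>1 / a\<close>, where the zeros
  force \<open>p'\<close> to be large and AM-GM forces it to be small, yields
  \<open>1 + N \<delta> (1 - a m / 2) \<le> exp (N \<delta> a (2 m - a) / 2)\<close>, so \<open>N\<close> is large in terms of \<open>a\<close> and \<open>m\<close>.
  On the other hand \<open>P(\<sigma>) = \<Prod> (1 + w\<^sub>j \<sigma>)\<close> is the derivative of \<open>I(\<sigma>) = \<sigma> \<Prod> (1 + u\<^sub>k \<sigma>)\<close>, and
  \<open>f(\<sigma>) = (1 + v \<sigma>) P(\<sigma>) - n v I(\<sigma>)\<close> satisfies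
  \<open>(1 + v \<sigma>) f'(\<sigma>) = - \<sigma> \<Sum> (w\<^sub>j - v)\<^sup>2 \<Prod>\<^sub>i\<^sub>\<noteq>\<^sub>j (1 + w\<^sub>i \<sigma>)\<close>, so \<open>f\<close> stays close to \<open>f(0) = 1\<close>. At
  \<open>\<sigma> = a\<close> (or \<open>\<sigma> = m\<close> when \<open>m < a\<close>) the zeros being in the disk give \<open>n \<bar>I(\<sigma>)\<bar> \<le> a\<close>, while \<open>P(\<sigma>)\<close> is
  exponentially small in \<open>N\<close>. Hence \<open>\<bar>f(\<sigma>)\<bar>\<close> is at most \<open>a \<bar>v\<bar>\<close> plus small terms, which
  contradicts \<open>f(\<sigma>) \<approx> 1\<close>.
\<close>

section \<open>Inequalities between real parameters\<close>

text \<open>The quadratic in \<open>quad\<close> is, up to a negative factor, the derivative of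
  \<open>(1 - y) exp (c y) / (1 + (c - 1) y + B y\<^sup>2)\<close> divided by \<open>y\<close>.\<close>

lemma one_minus_mult_exp_le:
  fixes c B x :: real
  assumes "1 \<le> c" "0 \<le> B" "0 \<le> x" "x \<le> 1"
    and quad: "\<And>y. \<lbrakk>0 \<le> y; y \<le> 1\<rbrakk> \<Longrightarrow>
      0 \<le> (2 * B - c\<^sup>2 + 2 * c) + (c\<^sup>2 - c - B * (1 + c)) * y + c * B * y\<^sup>2"
  shows "(1 - x) * exp (c * x) \<le> 1 + (c - 1) * x + B * x\<^sup>2"
proof -
  define Q where "Q y = 1 + (c - 1) * y + B * y\<^sup>2" for y
  define G where "G y = (1 - y) * exp (c * y) / Q y" for y
  have Qpos: "0 < Q y" if "0 \<le> y" for y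
    unfolding Q_def using assms that by (intro add_pos_nonneg) auto
  have "G x \<le> G 0"
  proof (rule DERIV_nonpos_imp_nonincreasing[of 0 x G])
    fix y assume y: "0 \<le> y" "y \<le> x"
    define num where "num = (1 - y) * (c - 1 + 2 * B * y) + Q y - c * (1 - y) * Q y"
    have "(G has_real_derivative - exp (c * y) * num / (Q y)\<^sup>2) (at y)"
      unfolding G_def num_def
      apply (rule derivative_eq_intros refl | simp add: Q_def)+
      using Qpos[OF y(1)] unfolding Q_def
       apply simp
      using Qpos[OF y(1)] unfolding Q_def
      by (simp add: field_simps power2_eq_square)
    moreover have "num = y * ((2 * B - c\<^sup>2 + 2 * c) + (c\<^sup>2 - c - B * (1 + c)) * y + c * B * y\<^sup>2)"
      unfolding num_def Q_def by (simp add: algebra_simps power2_eq_square)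
    moreover have "0 \<le> (2 * B - c\<^sup>2 + 2 * c) + (c\<^sup>2 - c - B * (1 + c)) * y + c * B * y\<^sup>2"
      using y assms by (intro quad) auto
    ultimately show "\<exists>D. (G has_real_derivative D) (at y) \<and> D \<le> 0"
      using y by (intro exI[of _ "- exp (c * y) * num / (Q y)\<^sup>2"]) (simp add: divide_nonpos_nonneg mult_nonneg_nonneg)
  qed (use assms in auto)
  then show ?thesis
    using Qpos[OF assms(3)] unfolding G_def by (simp add: Q_def field_simps)
qed

section \<open>Lower bounds for the degree from exponential growth\<close>

lemma exp_chord:
  fixes t T :: real
  assumes "0 \<le> t" "t \<le> T" "0 < T"
  shows "T * (exp t - 1) \<le> t * (exp T - 1)"
proof -
  have "exp ((1 - t/T) *\<^sub>R 0 + (t/T) *\<^sub>R T) \<le> (1 - t/T) * exp 0 + (t/T) * exp T"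
    by (rule convex_onD[where A = UNIV])
      (use assms in \<open>auto intro!: convex_on_realI[where f' = exp] derivative_eq_intros simp: field_simps\<close>)
  then have "exp t \<le> 1 + (t / T) * (exp T - 1)" using assms by (simp add: algebra_simps)
  then have "T * exp t \<le> T * (1 + (t / T) * (exp T - 1))" using assms by (intro mult_left_mono) auto
  then show ?thesis using assms by (simp add: algebra_simps)
qed

text \<open>By convexity \<open>(exp x - 1) / x\<close> is nondecreasing for \<open>x > 0\<close>;
  it is at most \<open>r\<close> at \<open>T\<close> and at least \<open>s > r\<close> at
  \<open>t\<close>. Thus an explicit trial value \<open>T\<close> becomes a lower bound for a
  \<open>t\<close> known only through an exponential inequality.\<close>

lemma exp_ratio_lower:
  fixes t T r s :: real
  assumes "0 < t" "0 < T" "exp T \<le> 1 + T * r" "1 + t * s \<le> exp t" "r < s"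
  shows "T \<le> t"
proof (rule ccontr)
  assume "\<not> T \<le> t"
  then have "T * (exp t - 1) \<le> t * (exp T - 1)"
    using assms by (intro exp_chord) auto
  also have "\<dots> \<le> t * (T * r)" using assms by (intro mult_left_mono) auto
  finally have "exp t - 1 \<le> t * r" using assms by (simp add: mult.left_commute)
  moreover have "t * r < t * s" using assms by simp
  ultimately show False using assms by linarith
qed

lemma degree_lower_pade:
  fixes N \<delta> \<kappa> b :: real
  assumes "0 < N" "0 < \<delta>" "0 < \<kappa>" "0 < b" "1 + N * \<delta> * b \<le> exp (N * \<delta> * \<kappa> / 2)"
  shows "4 * b - 2 * \<kappa> \<le> N * \<delta> * \<kappa> * b"
proof -
  define t where "t = N * \<delta> * \<kappa> / 2"
  have t: "0 < t" unfolding t_def using assms by simp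
  show ?thesis
  proof (cases "t < 2")
    case True
    have "(1 - t/2) * exp (2 * (t/2)) \<le> 1 + (2 - 1) * (t/2) + 0 * (t/2)\<^sup>2"
      by (rule one_minus_mult_exp_le) (use True t in auto)
    then have "(2 - t) * exp t \<le> 2 + t" by (simp add: algebra_simps)
    moreover have "(2 - t) * (1 + N * \<delta> * b) \<le> (2 - t) * exp t"
      using True assms by (intro mult_left_mono) (auto simp: t_def)
    ultimately have "(2 - t) * (N * \<delta> * b) \<le> 2 * t" by (simp add: algebra_simps)
    then have "(N * \<delta>) * ((2 - t) * b) \<le> (N * \<delta>) * \<kappa>" by (simp add: t_def algebra_simps)
    then have "(2 - t) * b \<le> \<kappa>" using assms by simp
    then show ?thesis by (simp add: t_def algebra_simps)
  next
    case False
    then have "4 * b \<le> N * \<delta> * \<kappa> * b" using assms by (intro mult_right_mono) (auto simp: t_def)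
    then show ?thesis using assms by linarith
  qed
qed

text \<open>With \<open>t = N * \<delta> * \<kappa> / 2\<close> the hypothesis reads
  \<open>1 + t * ((1 + g) / \<kappa>) \<le> exp t\<close>. The claim is
  \<open>35/10 * x \<le> t\<close> for the \<open>x\<close> defined in the proof, so
  \<open>35/10 * x\<close> is the trial value for \<open>exp_ratio_lower\<close>.\<close>

lemma degree_lower_mean_ge:
  fixes N a m :: real
  defines "\<delta> \<equiv> 1 - a\<^sup>2" and "\<kappa> \<equiv> a * (2 * m - a)" and "g \<equiv> 1 - a * m"
  assumes a: "0 < a" "a < 1" and m: "a \<le> m" "m \<le> 1" and N: "0 < N"
    and c1: "1 + N * \<delta> * ((1 + g) / 2) \<le> exp (N * \<delta> * \<kappa> / 2)"
  shows "7 * a\<^sup>2 * (1 - m\<^sup>2) \<le> N * \<kappa>\<^sup>2 * g"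
proof -
  have am: "a * m < 1" "a * a \<le> a * m" "m * m \<le> 1" "a * a < 1"
    using a m mult_strict_mono[of a 1 m 1] mult_mono[of m 1 m 1] mult_strict_mono[of a 1 a 1]
    by (auto intro: mult_left_mono simp: mult_le_one) (metis less_le_trans mult_le_cancel_left1 mult_less_cancel_left1 mult.commute mult_left_le not_le)
  have g: "0 < g" "g < 1" and \<delta>: "0 < \<delta>" "\<delta> < 1" and kap: "0 < \<kappa>" "g \<le> \<delta>"
    using am a m unfolding g_def \<delta>_def \<kappa>_def by (auto simp: power2_eq_square)
  define S where "S = 2 * g - g\<^sup>2 - \<delta>"
  have S: "S = a\<^sup>2 * (1 - m\<^sup>2)" unfolding S_def g_def \<delta>_def by (simp add: power2_eq_square algebra_simps)
  have S0: "0 \<le> S" unfolding S using am by (simp add: power2_eq_square)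
  have kg: "\<kappa> = 1 - 2 * g + \<delta>" unfolding g_def \<delta>_def \<kappa>_def by (simp add: power2_eq_square algebra_simps)
  define x where "x = \<delta> * S / (g * \<kappa>)"
  show ?thesis
  proof (cases "S = 0")
    case True
    then have "7 * (a\<^sup>2 * (1 - m\<^sup>2)) = 0" using S by simp
    moreover have "0 \<le> N * \<kappa>\<^sup>2 * g" using g N by simp
    ultimately show ?thesis by (simp only: mult.assoc)
  next
    case False
    with S0 have Sp: "0 < S" by simp
    \<comment> \<open>\<open>f\<close> runs from 0 at \<open>m = a\<close> to 1 at
      \<open>m = 1\<close>; in terms of \<open>k\<close> and \<open>f\<close> all quantities are
      polynomials.\<close>
    define k where "k = 1 - g"
    define f where "f = (\<delta> - g) / (g * k)"
    have k: "0 < k" "k < 1" and gk: "g = 1 - k" using g unfolding k_def by auto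
    have df: "\<delta> = g + g * k * f" unfolding f_def using g k by (simp add: field_simps)
    have f: "0 \<le> f" "f \<le> 1" unfolding f_def using g k kap Sp
      by (auto simp: field_simps S_def k_def power2_eq_square)
    have e1: "\<kappa> = k * (1 + g * f)" unfolding kg df gk by (simp add: algebra_simps)
    have e2: "S = g * k * (1 - f)" unfolding S_def df gk by (simp add: algebra_simps power2_eq_square)
    have "14/100 - f + 186/100 * f\<^sup>2 = 186/100 * (f - 100/372)\<^sup>2 + (14/100 - 100/744)"
      by (simp add: power2_eq_square field_simps)
    then have pos: "0 < 14/100 - f + 186/100 * f\<^sup>2" by (simp add: add_nonneg_pos)
    \<comment> \<open>The gap in \<open>key\<close> is a sum of nonnegative terms; the first is
      positive because its quadratic in \<open>f\<close> has negative discriminant.\<close>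
    have "(1 + g * f) * (2 - k * f) - (1 + k * f) * (1 - f) * (1 + g + 86/100 * \<kappa>)
      = k * (14/100 - f + 186/100 * f\<^sup>2) + g * f * (4 - k - 86/100 * (k * f))
        + 86/100 * (k * g * f) * (g * f + k * f\<^sup>2)"
      unfolding e1 gk by (simp add: field_simps power2_eq_square)
    moreover have "0 < k * (14/100 - f + 186/100 * f\<^sup>2)" using k pos by simp
    moreover have "k * f \<le> 1" using k f by (simp add: mult_le_one)
    then have "0 \<le> 4 - k - 86/100 * (k * f)" using k by linarith
    then have "0 \<le> g * f * (4 - k - 86/100 * (k * f))" using g f by (intro mult_nonneg_nonneg) auto
    moreover have "0 \<le> 86/100 * (k * g * f) * (g * f + k * f\<^sup>2)" using k g f by simp
    ultimately have key: "(1 + k * f) * (1 - f) * (1 + g + 86/100 * \<kappa>) < (1 + g * f) * (2 - k * f)"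
      by linarith
    have x0: "0 < x" unfolding x_def using Sp \<delta> g kap by simp
    have xk: "x * \<kappa> = \<delta> * S / g" unfolding x_def using kap by simp
    have dS: "\<delta> * S / g = (1 + k * f) * (g * k * (1 - f))"
      unfolding df e2 using g by (simp add: field_simps)
    have gk2: "1 + g - \<kappa> = g * (2 - k * f)" unfolding e1 gk by (simp add: algebra_simps power2_eq_square)
    have "x * \<kappa> * (1 + g + 86/100 * \<kappa>) = g * k * ((1 + k * f) * (1 - f) * (1 + g + 86/100 * \<kappa>))"
      unfolding xk dS by (simp only: mult_ac)
    also have "\<dots> < g * k * ((1 + g * f) * (2 - k * f))" using key g k by simp
    also have "\<dots> = \<kappa> * (1 + g - \<kappa>)" unfolding gk2 unfolding e1 by (simp add: algebra_simps)
    finally have "x * (1 + g + 86/100 * \<kappa>) < 1 + g - \<kappa>" using kap by (simp add: mult.assoc mult.left_commute)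
    then have main: "\<kappa> * (1 + 86/100 * x) < (1 + g) * (1 - x)" by (simp add: algebra_simps)
    moreover have "0 < \<kappa> * (1 + 86/100 * x)" using kap x0 by simp
    ultimately have x1: "x < 1" using g by (smt (verit) mult_nonneg_nonpos)
    \<comment> \<open>Since \<open>301/100 = 35/10 * (86/100)\<close>, the right-hand side is
      \<open>(1 - x) + 35/10 * x * (1 + 86/100 * x)\<close>, the shape required by
      \<open>exp_ratio_lower\<close> after division by \<open>1 - x\<close>.\<close>
    have "(1 - x) * exp (35/10 * x) \<le> 1 + (35/10 - 1) * x + 301/100 * x\<^sup>2"
    proof (rule one_minus_mult_exp_le)
      fix y :: real assume y: "0 \<le> y" "y \<le> 1"
      have "0 \<le> 77/100 - 4795/1000 * y + 10535/1000 * y\<^sup>2"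
        using zero_le_power2[of "y - 4795/21070"] by (simp add: power2_eq_square algebra_simps)
      then show "0 \<le> 2 * (301/100) - (35/10)\<^sup>2 + 2 * (35/10) + ((35/10)\<^sup>2 - 35/10 - 301/100 * (1 + 35/10)) * y + 35/10 * (301/100) * y\<^sup>2"
        by (simp add: power2_eq_square)
    qed (use x0 x1 in auto)
    then have "exp (35/10 * x) \<le> 1 + 35/10 * x * ((1 + 86/100 * x) / (1 - x))"
      using x1 by (simp add: field_simps power2_eq_square)
    moreover have "(1 + 86/100 * x) / (1 - x) < (1 + g) / \<kappa>"
    proof -
      have "(1 + 86/100 * x) * \<kappa> < (1 + g) * (1 - x)" using main by (simp only: mult.commute)
      then have "(1 + 86/100 * x) < (1 + g) * (1 - x) / \<kappa>" using kap by (subst pos_less_divide_eq) auto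
      then show ?thesis using x1 by (subst pos_divide_less_eq) auto
    qed
    moreover have "1 + N * \<delta> * \<kappa> / 2 * ((1 + g) / \<kappa>) \<le> exp (N * \<delta> * \<kappa> / 2)"
      using c1 kap by simp
    moreover have "0 < N * \<delta> * \<kappa> / 2" using N \<delta> kap by simp
    moreover have "0 < 35/10 * x" using x0 by simp
    ultimately have "35/10 * x \<le> N * \<delta> * \<kappa> / 2"
      by (blast intro: exp_ratio_lower)
    then have "7 * (\<delta> * S) \<le> N * \<delta> * \<kappa> * (g * \<kappa>)"
      unfolding x_def using g kap by (simp add: field_simps)
    then have "\<delta> * (7 * S) \<le> \<delta> * (N * \<kappa>\<^sup>2 * g)" by (simp add: algebra_simps power2_eq_square)
    then show ?thesis using \<delta> unfolding S by simp
  qed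
qed

text \<open>The trial value is now \<open>37/10 * g\<close>. The strict comparison of slopes comes
  from \<open>\<kappa> < 1 - g\<close>, which holds because \<open>m < a\<close> means
  \<open>\<delta> < g\<close>.\<close>

lemma degree_lower_mean_less:
  fixes N a m :: real
  defines "\<delta> \<equiv> 1 - a\<^sup>2" and "\<kappa> \<equiv> a * (2 * m - a)" and "g \<equiv> 1 - a * m"
  assumes a: "0 < a" "a < 1" and m: "m < a" and kap: "0 < \<kappa>" and N: "0 < N"
    and c1: "1 + N * \<delta> * ((1 + g) / 2) \<le> exp (N * \<delta> * \<kappa> / 2)"
  shows "74/10 * g \<le> N * \<delta> * \<kappa>"
proof -
  have am: "0 < a * m" "a * m < a * a" "a * a < 1"
  proof -
    show "0 < a * m" using a kap unfolding \<kappa>_def by (auto simp: zero_less_mult_iff)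
    show "a * m < a * a" using a m by simp
    show "a * a < 1" using a mult_strict_mono[of a 1 a 1] by simp
  qed
  have g: "0 < g" "g < 1" and \<delta>: "0 < \<delta>" "\<delta> < g"
    unfolding g_def \<delta>_def power2_eq_square using am a by linarith+
  have kg: "\<kappa> = 1 - 2 * g + \<delta>" unfolding g_def \<delta>_def \<kappa>_def by (simp add: power2_eq_square algebra_simps)
  have "(1 - g) * exp (37/10 * g) \<le> 1 + (37/10 - 1) * g + 37/10 * g\<^sup>2"
  proof (rule one_minus_mult_exp_le)
    fix y :: real assume y: "0 \<le> y" "y \<le> 1"
    have "0 \<le> 111/100 - 74/10 * y + 1369/100 * y\<^sup>2"
      using zero_le_power2[of "y - 740/2738"] by (simp add: power2_eq_square algebra_simps)
    then show "0 \<le> 2 * (37/10) - (37/10)\<^sup>2 + 2 * (37/10) + ((37/10)\<^sup>2 - 37/10 - 37/10 * (1 + 37/10)) * y + 37/10 * (37/10) * y\<^sup>2"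
      by (simp add: power2_eq_square)
  qed (use g in auto)
  then have "exp (37/10 * g) \<le> 1 + 37/10 * g * ((1 + g) / (1 - g))"
    using g by (simp add: field_simps power2_eq_square)
  moreover have "(1 + g) / (1 - g) < (1 + g) / \<kappa>"
    using g \<delta> kap by (intro divide_strict_left_mono) (auto simp: kg)
  moreover have "1 + N * \<delta> * \<kappa> / 2 * ((1 + g) / \<kappa>) \<le> exp (N * \<delta> * \<kappa> / 2)"
    using c1 kap by simp
  moreover have "0 < N * \<delta> * \<kappa> / 2" using N \<delta> kap by simp
  moreover have "0 < 37/10 * g" using g by simp
  ultimately have "37/10 * g \<le> N * \<delta> * \<kappa> / 2"
    by (blast intro: exp_ratio_lower)
  then show ?thesis by simp
qed

text \<open>\<open>le\<close> is the square of the first claim of \<open>outer_bound\<close>: there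
  \<open>(3 + \<delta> - \<kappa>) / 4\<close> equals \<open>1 - a * m / 2\<close>. Each of the four
  small degrees contradicts it directly.\<close>

lemma degree_ge_five:
  fixes \<delta> \<kappa> :: real and N :: nat
  assumes "0 < \<delta>" "\<delta> \<le> 1" "\<kappa> < 1" "0 < N"
    and le: "(1 + N * \<delta> * ((3 + \<delta> - \<kappa>) / 4))\<^sup>2 \<le> (1 + \<delta> * \<kappa>) ^ N" and kap: "0 < \<kappa>"
  shows "5 \<le> N"
proof (rule ccontr)
  define b where "b = (3 + \<delta> - \<kappa>) / 4"
  have b: "1/2 < b" "\<kappa> < 2 * b" "(2 + \<delta>) / 4 < b" unfolding b_def using assms by auto
  have dk: "\<delta> * \<kappa> < \<delta>" using assms by simp
  have le': "(1 + N * \<delta> * b)\<^sup>2 \<le> (1 + \<delta> * \<kappa>) ^ N" using le unfolding b_def .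
  assume "\<not> 5 \<le> N"
  with assms(4) consider "N = 1" | "N = 2" | "N = 3" | "N = 4" by linarith
  then show False
  proof cases
    case 1
    have "1 + 2 * (\<delta> * b) \<le> (1 + \<delta> * b)\<^sup>2"
      using zero_le_power2[of "\<delta> * b"] by (simp add: power2_eq_square algebra_simps)
    also have "\<dots> \<le> 1 + \<delta> * \<kappa>" using le' 1 by simp
    finally have "\<delta> * (2 * b) \<le> \<delta> * \<kappa>" by simp
    then show False using b assms by simp
  next
    case 2
    have "(1 + 2 * \<delta> * b)\<^sup>2 \<le> (1 + \<delta> * \<kappa>)\<^sup>2" using le' 2 by simp
    then have "1 + 2 * \<delta> * b \<le> 1 + \<delta> * \<kappa>"
      using assms b by (subst (asm) abs_le_square_iff[symmetric]) (simp add: abs_of_nonneg)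
    then have "\<delta> * (2 * b) \<le> \<delta> * \<kappa>" by simp
    then show False using b assms by simp
  next
    case 3
    \<comment> \<open>Replacing \<open>\<kappa>\<close> by 1 lowers the left side and raises the
      right side, so a polynomial inequality in \<open>\<delta>\<close> alone remains to be
      refuted.\<close>
    have "(1 + 3 * \<delta> * ((2 + \<delta>) / 4))\<^sup>2 \<le> (1 + 3 * \<delta> * b)\<^sup>2"
      using b assms by (intro power_mono add_mono mult_mono) auto
    also have "\<dots> \<le> (1 + \<delta> * \<kappa>) ^ 3" using le' 3 by simp
    also have "\<dots> \<le> (1 + \<delta>) ^ 3" using dk assms by (intro power_mono) auto
    finally have "0 \<le> \<delta>\<^sup>2 * (3 - 1.5 - 2.25 + (1 - 2.25) * \<delta> - 0.5625 * \<delta>\<^sup>2)"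
      by (simp add: power2_eq_square power3_eq_cube field_simps)
    moreover have "0 < \<delta>\<^sup>2" "0 \<le> 0.5625 * \<delta>\<^sup>2" using assms by auto
    ultimately show False using assms by (simp add: zero_le_mult_iff)
  next
    case 4
    have "(1 + 4 * \<delta> * b)\<^sup>2 \<le> ((1 + \<delta> * \<kappa>)\<^sup>2)\<^sup>2" using le' 4 by (simp flip: power_mult)
    then have "1 + 4 * \<delta> * b \<le> (1 + \<delta> * \<kappa>)\<^sup>2"
      using assms b by (subst (asm) abs_le_square_iff[symmetric]) (simp add: abs_of_nonneg)
    then have "\<delta> * (4 * b) \<le> \<delta> * (2 * \<kappa> + \<delta> * \<kappa> * \<kappa>)" by (simp add: power2_eq_square algebra_simps)
    then have "3 + \<delta> - \<kappa> \<le> 2 * \<kappa> + \<delta> * \<kappa> * \<kappa>" using assms by (simp add: b_def)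
    moreover have "\<delta> * \<kappa> * \<kappa> \<le> \<delta>" using dk assms kap mult_le_one[of \<kappa> \<kappa>] mult_left_le[of "\<kappa> * \<kappa>" \<delta>] by (simp add: less_imp_le mult.assoc)
    ultimately show False using assms by linarith
  qed
qed

section \<open>Numerical bounds for the AM-GM loss and for the error terms\<close>

lemma sqrt_power_bounds:
  fixes N :: nat
  assumes "5 \<le> N"
  defines "\<gamma> \<equiv> sqrt (N / (N - 1)) ^ (N - 1)"
  shows "3/2 \<le> \<gamma>" "\<gamma> \<le> 165/100"
proof -
  define k where "k = N - 1"
  have k: "4 \<le> k" "N = Suc k" using assms unfolding k_def by auto
  have sq: "\<gamma>\<^sup>2 = (1 + 1 / k) ^ k"
    unfolding \<gamma>_def using k by (simp add: power2_eq_square field_simps flip: power_mult_distrib)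
  have pos: "0 \<le> \<gamma>" unfolding \<gamma>_def by simp
  \<comment> \<open>The upper bound is \<open>exp 1 < (165/100)\<^sup>2\<close>.\<close>
  have "(1 + 1 / k) ^ k \<le> exp (1 / k) ^ k" by (intro power_mono) auto
  also have "\<dots> = exp 1" using k by (simp flip: exp_of_nat_mult)
  also have "\<dots> < (165/100)\<^sup>2" using e_less_272 by (simp add: power2_eq_square)
  finally have "\<gamma>\<^sup>2 \<le> (165/100)\<^sup>2" unfolding sq by simp
  then show "\<gamma> \<le> 165/100" by (rule power2_le_imp_le) simp
  have ind: "1 + real j * x + real j * (real j - 1) / 2 * x\<^sup>2 \<le> (1 + x) ^ j" if "0 \<le> x" for x :: real and j
  proof (induction j)
    case (Suc j)
    have "1 + real (Suc j) * x + real (Suc j) * (real (Suc j) - 1) / 2 * x\<^sup>2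
        \<le> (1 + x) * (1 + real j * x + real j * (real j - 1) / 2 * x\<^sup>2)"
    proof (cases j)
      case (Suc i)
      then show ?thesis using that by (simp add: algebra_simps power2_eq_square field_simps)
    qed (use that in auto)
    also have "\<dots> \<le> (1 + x) * (1 + x) ^ j" using Suc that by (intro mult_left_mono) auto
    finally show ?case by simp
  qed auto
  \<comment> \<open>Three terms of the binomial expansion give \<open>2 + (k - 1) / (2 * k)\<close>,
    at least 19/8 for \<open>k \<ge> 4\<close>.\<close>
  have "(3/2)\<^sup>2 \<le> 1 + real k * (1/k) + real k * (real k - 1) / 2 * (1/k)\<^sup>2"
    using k by (simp add: power2_eq_square field_simps)
  also have "\<dots> \<le> (1 + 1 / k) ^ k" by (rule ind) simp
  finally have "(3/2)\<^sup>2 \<le> \<gamma>\<^sup>2" unfolding sq .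
  then show "3/2 \<le> \<gamma>" using pos by (rule power2_le_imp_le)
qed

text \<open>The numerical half of the contradiction at \<sigma> = \<open>a\<close> when
  \<open>a \<le> m\<close>. The first summand is \<open>\<Phi> a * sqrt (\<Phi> a) ^ (N - 1)\<close>
  from \<open>one_minus_le\<close>, the second the bound of \<open>f_deviation_main\<close>.
  Bounding the latter by \<open>V * (\<psi> * (Y - R * p))\<close> makes the total a combination of
  \<open>R * p\<close> and \<open>Y\<close>.\<close>

lemma error_terms_less_mean_ge:
  fixes N :: nat and a m M \<gamma> \<delta> \<kappa> R p :: real
  defines "\<delta> \<equiv> 1 - a\<^sup>2" and "\<kappa> \<equiv> a * (2 * m - a)"
  defines "R \<equiv> 1 - \<kappa>"
  defines "p \<equiv> sqrt R ^ (N - 1)"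
  assumes a: "0 < a" "a < 1" and m: "a \<le> m" "m \<le> M" "M \<le> 1" and N: "5 \<le> N"
    and c1: "1 + N * \<delta> * (1 - a * m / 2) \<le> exp (N * \<delta> * \<kappa> / 2)"
    and \<gamma>: "3/2 \<le> \<gamma>" "\<gamma> \<le> 165/100"
  shows "R * p + (1 - M\<^sup>2) * (N * \<gamma> / (\<kappa> / a)\<^sup>2 * (2 * (1 - p) / (real N - 1) - 2 * (1 - R * p) / (real N + 1))) < 1 - a * M"
proof -
  define n where "n = real N"
  define g where "g = 1 - a * m"
  have n: "5 \<le> n" unfolding n_def using N by simp
  have aa: "a * a \<le> a * m" "a * m \<le> a" "a * a < a" using a m by (auto simp: mult_left_le)
  have g: "0 < g" "g < 1" using aa a m mult_pos_pos[of a m] unfolding g_def by linarith+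
  have \<delta>: "0 < \<delta>" "\<delta> < 1" "g \<le> \<delta>" using aa a mult_pos_pos[of a a] unfolding \<delta>_def g_def power2_eq_square by linarith+
  have Rg: "R = 2 * g - \<delta>" unfolding R_def \<kappa>_def g_def \<delta>_def by (simp add: algebra_simps power2_eq_square)
  have "(1 - a)\<^sup>2 \<le> R" unfolding R_def \<kappa>_def using aa by (simp add: algebra_simps power2_eq_square)
  then have R0: "0 < R" using a by (smt (verit) zero_less_power2)
  have kap: "0 < \<kappa>" "\<kappa> < 1" using aa a R0 unfolding \<kappa>_def R_def by (auto simp: algebra_simps)
  have Rd: "R \<le> g" "R \<le> \<delta>" using Rg \<delta> by auto
  define b where "b = (1 + g) / 2"
  have bb: "1 - a * m / 2 = b" unfolding b_def g_def by simp
  have b: "0 < b" "b \<le> 1" unfolding b_def using g by auto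
  have c1': "1 + n * \<delta> * b \<le> exp (n * \<delta> * \<kappa> / 2)" using c1 unfolding n_def bb .
  have da: "\<delta> = (1 - a) * (1 + a)" unfolding \<delta>_def by (simp add: algebra_simps power2_eq_square)
  have pade: "4 * R \<le> n * \<delta> * \<kappa> * b"
  proof -
    have "4 * b - 2 * \<kappa> \<le> n * \<delta> * \<kappa> * b"
      by (rule degree_lower_pade) (use n \<delta> kap b c1' in auto)
    moreover have "4 * b - 2 * \<kappa> = 3 * R + \<delta>" using Rg R_def b_def by argo
    ultimately show ?thesis using Rd by linarith
  qed
  have p0: "0 \<le> p" unfolding p_def using R0 by simp
  have psq: "p\<^sup>2 = R ^ (N - 1)" unfolding p_def using R0 by (simp flip: power_mult add: mult.commute power_mult)
  have "p\<^sup>2 \<le> (1/2)\<^sup>2"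
  proof (cases "R \<le> 1/2")
    case True
    have "R ^ (N - 1) \<le> R ^ 2" using N R0 True by (intro power_decreasing) auto
    also have "\<dots> \<le> (1/2)\<^sup>2" using True R0 by (intro power_mono) auto
    finally show ?thesis unfolding psq .
  next
    case False
    \<comment> \<open>For \<open>R > 1/2\<close>, \<open>pade\<close> gives
      \<open>(N - 1) * \<kappa> / R \<ge> 3\<close>, so Bernoulli's inequality bounds
      \<open>(1 / R) ^ (N - 1)\<close> below by 4.\<close>
    have "n * \<delta> * \<kappa> * b \<le> n * 1 * \<kappa> * 1" using n \<delta> kap b by (intro mult_mono) auto
    then have "3 * R \<le> (n - 1) * \<kappa>" using pade False unfolding R_def by (simp add: algebra_simps)
    then have "4 \<le> 1 + real (N - 1) * (\<kappa> / R)" using R0 N by (simp add: n_def field_simps of_nat_diff)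
    also have "\<dots> \<le> (1 + \<kappa> / R) ^ (N - 1)" by (rule Bernoulli_inequality) (use R0 kap in \<open>auto intro: order_trans[of _ 0]\<close>)
    also have "1 + \<kappa> / R = 1 / R" using R0 unfolding R_def by (simp add: field_simps)
    finally have "4 * R ^ (N - 1) \<le> 1" using R0 by (simp add: power_divide field_simps)
    then show ?thesis unfolding psq by (simp add: power2_eq_square)
  qed
  then have p: "p \<le> 1/2" by (rule power2_le_imp_le) simp
  have da2: "\<delta> < 2 * (1 - a)" using mult_strict_left_mono[of "1 + a" 2 "1 - a"] a unfolding da by simp
  have T: "R * p < 1 - a"
  proof -
    have "R * p \<le> \<delta> * (1/2)" using p p0 Rd R0 \<delta> by (intro mult_mono) auto
    then show ?thesis using da2 by simp
  qed
  define Y where "Y = 2 * R / (\<kappa> * (n + 1))"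
  have Y: "Y < 1 - a"
  proof -
    have "2 * (4 * R) \<le> 2 * (n * \<delta> * \<kappa> * b)" using pade by linarith
    also have "\<dots> \<le> 2 * (n * \<delta> * \<kappa> * 1)" using n \<delta> kap b by (intro mult_left_mono) auto
    also have "\<dots> < 2 * (n * (2 * (1 - a)) * \<kappa>)" using n \<delta> kap da2 by simp
    also have "\<dots> \<le> 4 * (1 - a) * (\<kappa> * (n + 1))" using n kap a by (simp add: algebra_simps)
    finally have "4 * (2 * R) < 4 * ((1 - a) * (\<kappa> * (n + 1)))" by (simp only: mult.assoc)
    then have "2 * R < (1 - a) * (\<kappa> * (n + 1))" by (subst (asm) mult_less_cancel_left_pos) auto
    then show ?thesis unfolding Y_def using kap n by (subst pos_divide_less_eq) auto
  qed
  have MM: "0 < M" "1 - a \<le> 1 - a * M" "0 < 1 - a * M" using a m by (auto simp: mult_left_le) (smt (verit) mult_left_le)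
  define V where "V = 1 - M\<^sup>2"
  have V: "0 \<le> V" unfolding V_def using MM m by (simp add: power_le_one)
  define \<psi> where "\<psi> = 2 * \<gamma> * a\<^sup>2 * n / ((n - 1) * \<kappa> * R)"
  have \<psi>: "0 \<le> \<psi>" unfolding \<psi>_def using \<gamma> n kap R0 by simp
  have bracket: "n * \<gamma> / (\<kappa> / a)\<^sup>2 * (2 * (1 - p) / (n - 1) - 2 * (1 - R * p) / (n + 1)) \<le> \<psi> * (Y - R * p)"
  proof -
    have "2 * (1 - p) / (n - 1) - 2 * (1 - R * p) / (n + 1)
        = (2 / (n - 1) - 2 / (n + 1)) - p * (2 / (n - 1) - 2 * R / (n + 1))"
      by (simp add: algebra_simps diff_divide_distrib)
    also have "2 / (n - 1) - 2 / (n + 1) = 4 / ((n - 1) * (n + 1))"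
      using n by (subst diff_frac_eq) auto
    also have "2 * R / (n + 1) \<le> 2 * R / (n - 1)" using n R0 by (intro divide_left_mono) auto
    then have "4 / ((n - 1) * (n + 1)) - p * (2 / (n - 1) - 2 * R / (n + 1))
      \<le> 4 / ((n - 1) * (n + 1)) - p * (2 / (n - 1) - 2 * R / (n - 1))"
      using p0 by (intro diff_left_mono mult_left_mono) auto
    also have "\<dots> = 4 / ((n - 1) * (n + 1)) - p * (2 * \<kappa> / (n - 1))"
      unfolding R_def by (simp add: field_simps flip: diff_divide_distrib)
    finally have "n * \<gamma> / (\<kappa> / a)\<^sup>2 * (2 * (1 - p) / (n - 1) - 2 * (1 - R * p) / (n + 1))
      \<le> n * \<gamma> / (\<kappa> / a)\<^sup>2 * (4 / ((n - 1) * (n + 1)) - p * (2 * \<kappa> / (n - 1)))"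
      using n \<gamma> by (intro mult_left_mono) auto
    also have "\<dots> = \<psi> * (Y - R * p)"
    proof -
      have "n * \<gamma> / (\<kappa> / a)\<^sup>2 * (4 / (x * y) - p * (2 * \<kappa> / x))
        = 2 * \<gamma> * a\<^sup>2 * n / (x * \<kappa> * R) * (2 * R / (\<kappa> * y) - R * p)" if "0 < x" "0 < y" for x y
        using that n kap R0 a by (simp add: field_simps power2_eq_square)
      then show ?thesis unfolding \<psi>_def Y_def using n by simp
    qed
    finally show ?thesis .
  qed
  have le: "R * p + V * (n * \<gamma> / (\<kappa> / a)\<^sup>2 * (2 * (1 - p) / (n - 1) - 2 * (1 - R * p) / (n + 1)))
      \<le> R * p + V * (\<psi> * (Y - R * p))"
    using bracket V by (intro add_left_mono mult_left_mono) auto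
  have "R * p + V * (\<psi> * (Y - R * p)) < 1 - a * M"
  \<comment> \<open>For \<open>\<psi> * V < 1\<close> the total is a convex combination of
    \<open>R * p\<close> and \<open>Y\<close>, both below \<open>1 - a\<close>. Otherwise the
    coefficient of \<open>R * p\<close> is nonpositive, and bounding \<open>\<psi> * V * Y\<close>
    needs the sharper \<open>degree_lower_mean_ge\<close>.\<close>
  proof (cases "\<psi> * V < 1")
    case True
    have "R * p + V * (\<psi> * (Y - R * p)) = (1 - \<psi> * V) * (R * p) + (\<psi> * V) * Y" by (simp add: algebra_simps)
    also have "\<dots> < (1 - \<psi> * V) * (1 - a) + (\<psi> * V) * (1 - a)"
      using True T Y V \<psi> by (intro add_less_le_mono mult_strict_left_mono mult_left_mono) auto
    also have "\<dots> = 1 - a" by (simp add: algebra_simps)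
    finally show ?thesis using MM by linarith
  next
    case False
    have "(1 - \<psi> * V) * (R * p) \<le> 0" using False R0 p0 by (intro mult_nonpos_nonneg) auto
    then have "R * p + V * (\<psi> * (Y - R * p)) \<le> \<psi> * V * Y" by (simp add: algebra_simps)
    also have "\<dots> < 1 - a * M"
    proof -
      have low: "7 * a\<^sup>2 * (1 - m\<^sup>2) \<le> n * \<kappa>\<^sup>2 * g"
        unfolding \<kappa>_def g_def by (rule degree_lower_mean_ge)
          (use a m n c1' in \<open>auto simp: b_def \<delta>_def \<kappa>_def g_def\<close>)
      \<comment> \<open>\<open>low\<close> controls \<open>1 - m\<^sup>2\<close>, but
        \<open>V\<close> is \<open>1 - M\<^sup>2\<close>; this passes from one to the other.\<close>
      have Vg: "V * g \<le> (1 - m\<^sup>2) * (1 - a * M)"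
      proof -
        have "(1 - m\<^sup>2) * (1 - a * M) - V * g = (M - m) * (M * g + (m - a))"
          unfolding V_def g_def by (simp add: algebra_simps power2_eq_square)
        also have "\<dots> \<ge> 0" using m MM g by (intro mult_nonneg_nonneg add_nonneg_nonneg) auto
        finally show ?thesis by simp
      qed
      have n24: "24 * n\<^sup>2 \<le> 25 * (n\<^sup>2 - 1)" using n mult_mono[of 5 n 5 n] by (simp add: power2_eq_square)
      have n1: "0 < n\<^sup>2 - 1" using n mult_mono[of 5 n 5 n] by (simp add: power2_eq_square)
      have eq: "\<psi> * V * Y = 4 * \<gamma> * n * a\<^sup>2 * V / (\<kappa>\<^sup>2 * (n\<^sup>2 - 1))"
        unfolding \<psi>_def Y_def using n n1 kap R0 by (simp add: field_simps power2_eq_square)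
      \<comment> \<open>The constants close since \<open>66/70 * (25/24) < 1\<close>: 66/10 is four
        times the bound for \<open>\<gamma>\<close>, 7 comes from \<open>low\<close>, and 25/24
        bounds \<open>n\<^sup>2 / (n\<^sup>2 - 1)\<close> for \<open>n \<ge> 5\<close>.\<close>
      have "4 * \<gamma> * n * a\<^sup>2 * V * (n * g) \<le> 4 * (165/100) * n * a\<^sup>2 * V * (n * g)"
        using \<gamma> n V g by (intro mult_right_mono) auto
      also have "\<dots> = (66/10) * n\<^sup>2 * (a\<^sup>2 * (V * g))" by (simp add: power2_eq_square algebra_simps)
      also have "\<dots> \<le> (66/10) * n\<^sup>2 * (a\<^sup>2 * ((1 - m\<^sup>2) * (1 - a * M)))"
        using Vg by (intro mult_left_mono) auto
      also have "\<dots> = (66/70) * n\<^sup>2 * ((7 * a\<^sup>2 * (1 - m\<^sup>2)) * (1 - a * M))" by simp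
      also have "\<dots> \<le> (66/70) * n\<^sup>2 * ((n * \<kappa>\<^sup>2 * g) * (1 - a * M))"
        using low MM by (intro mult_left_mono mult_right_mono) auto
      also have "\<dots> = (66/70) * (24 * n\<^sup>2) / 24 * (n * \<kappa>\<^sup>2 * g * (1 - a * M))" by simp
      also have "\<dots> < (n\<^sup>2 - 1) * (n * \<kappa>\<^sup>2 * g * (1 - a * M))"
        using n24 n1 n kap g MM by (intro mult_strict_right_mono mult_pos_pos) auto
      finally have "(4 * \<gamma> * n * a\<^sup>2 * V) * (n * g) < ((1 - a * M) * (\<kappa>\<^sup>2 * (n\<^sup>2 - 1))) * (n * g)"
        by (simp add: algebra_simps)
      then have "4 * \<gamma> * n * a\<^sup>2 * V < (1 - a * M) * (\<kappa>\<^sup>2 * (n\<^sup>2 - 1))"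
        using n g by (simp add: mult_less_cancel_right)
      then show ?thesis unfolding eq using kap n1 by (subst pos_divide_less_eq) auto
    qed
    finally show ?thesis .
  qed
  with le have "R * p + V * (n * \<gamma> / (\<kappa> / a)\<^sup>2 * (2 * (1 - p) / (n - 1) - 2 * (1 - R * p) / (n + 1))) < 1 - a * M"
    by linarith
  then show ?thesis unfolding V_def n_def .
qed

text \<open>For \<open>m < a\<close> this is the cost of moving from 0 to \<open>m\<close>; it
  leaves nearly a tenth of \<open>1 - a * M\<close> for the remaining errors. The constant rounds up
  \<open>256/63 * (165/100) / (74/10)\<close>, where 256/63 comes from \<open>N \<ge> 8\<close> and
  74/10 from \<open>low\<close>.\<close>

lemma deviation_term_le:
  fixes N :: nat and a m M \<gamma> p r :: real
  assumes a: "0 < a" "a < 1" and m: "0 < m" "m \<le> M" "M \<le> 1" and N: "8 \<le> N"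
    and low: "74/10 * (1 - a * m) \<le> N * (1 - a\<^sup>2) * (a * (2 * m - a))"
    and \<gamma>: "0 \<le> \<gamma>" "\<gamma> \<le> 165/100" and p: "0 \<le> p" and r: "r \<le> 1"
  shows "(1 - M\<^sup>2) * (N * \<gamma> / m\<^sup>2 * (2 * (1 - p) / (real N - 1) - 2 * (1 - r * p) / (real N + 1)))
    \<le> 9061/10000 * (1 - a * M)"
proof -
  define n where "n = real N"
  have n: "8 \<le> n" unfolding n_def using N by simp
  define \<delta> where "\<delta> = 1 - a\<^sup>2"
  have \<delta>: "0 < \<delta>" using a unfolding \<delta>_def by (simp add: power_less_one_iff)
  have V: "0 \<le> 1 - M\<^sup>2" using m by (simp add: power_le_one)
  have aM: "0 < 1 - a * M"
  proof -
    have "a * M \<le> a * 1" using a m by (intro mult_left_mono) auto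
    then show ?thesis using a by linarith
  qed
  have "2 * (1 - p) / (n - 1) - 2 * (1 - r * p) / (n + 1)
        = (2 / (n - 1) - 2 / (n + 1)) - p * (2 / (n - 1) - 2 * r / (n + 1))"
    by (simp add: algebra_simps diff_divide_distrib)
  also have "2 / (n - 1) - 2 / (n + 1) = 4 / ((n - 1) * (n + 1))"
    using n by (subst diff_frac_eq) auto
  also have "2 * r / (n + 1) \<le> 2 / (n + 1)" using n r by (intro divide_right_mono) auto
  then have "2 * r / (n + 1) \<le> 2 / (n - 1)" using n frac_le[of 2 2 "n - 1" "n + 1"] by linarith
  then have "4 / ((n - 1) * (n + 1)) - p * (2 / (n - 1) - 2 * r / (n + 1)) \<le> 4 / ((n - 1) * (n + 1))"
    using p by simp
  also have "\<dots> \<le> 4 / (63 / 64 * n\<^sup>2)"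
  proof (intro divide_left_mono mult_pos_pos)
    have "8 * 8 \<le> n * n" using n by (intro mult_mono) auto
    then show "63 / 64 * n\<^sup>2 \<le> (n - 1) * (n + 1)" by (simp add: power2_eq_square algebra_simps)
  qed (use n in auto)
  finally have br: "2 * (1 - p) / (n - 1) - 2 * (1 - r * p) / (n + 1) \<le> 4 / (63 / 64 * n\<^sup>2)" .
  have "(1 - M\<^sup>2) * (n * \<gamma> / m\<^sup>2 * (2 * (1 - p) / (n - 1) - 2 * (1 - r * p) / (n + 1)))
    \<le> (1 - M\<^sup>2) * (n * (165/100) / m\<^sup>2 * (4 / (63 / 64 * n\<^sup>2)))"
    using V n \<gamma> m by (intro mult_left_mono order_trans[OF mult_left_mono[OF br] mult_right_mono]
      divide_right_mono mult_nonneg_nonneg divide_nonneg_nonneg) auto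
  also have "\<dots> = 256/63 * (165/100) * (1 - M\<^sup>2) / (n * m\<^sup>2)"
    using n m by (simp add: field_simps power2_eq_square)
  also have "\<dots> \<le> 256/63 * (165/100) * ((1 - a * M) * (n * m\<^sup>2 / (74/10))) / (n * m\<^sup>2)"
  proof (intro divide_right_mono mult_left_mono)
    have "\<delta> * (1 - M\<^sup>2) \<le> (1 - a * M) * (1 - a * M)"
      using zero_le_power2[of "a - M"] unfolding \<delta>_def by (simp add: power2_eq_square algebra_simps)
    also have "\<dots> \<le> (1 - a * M) * (1 - a * m)" using aM a m by (intro mult_left_mono) auto
    also have "\<dots> \<le> (1 - a * M) * (n * \<delta> * m\<^sup>2 / (74/10))"
    proof (rule mult_left_mono)
      have "a * (2 * m - a) \<le> m\<^sup>2" using zero_le_power2[of "a - m"] by (simp add: power2_eq_square algebra_simps)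
      then have "n * \<delta> * (a * (2 * m - a)) \<le> n * \<delta> * m\<^sup>2" using n \<delta> by (intro mult_left_mono) auto
      then show "1 - a * m \<le> n * \<delta> * m\<^sup>2 / (74/10)" using low unfolding n_def \<delta>_def by simp
    qed (use aM in auto)
    finally have "\<delta> * (1 - M\<^sup>2) \<le> \<delta> * ((1 - a * M) * (n * m\<^sup>2 / (74/10)))" by (simp add: mult_ac)
    then show "1 - M\<^sup>2 \<le> (1 - a * M) * (n * m\<^sup>2 / (74/10))" using \<delta> by simp
  qed (use n in auto)
  also have "\<dots> = (256/63 * (165/100) / (74/10)) * (1 - a * M)" using n m by simp
  also have "\<dots> \<le> 9061/10000 * (1 - a * M)" using aM by (intro mult_right_mono) auto
  finally show ?thesis unfolding n_def .
qed

lemma exp_lower_bound_power: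
  fixes x c :: real
  assumes "0 \<le> x" "c \<le> (1 + x + x\<^sup>2 / 2) ^ k"
  shows "c \<le> exp (k * x)"
proof -
  have "(1 + x + x\<^sup>2 / 2) ^ k \<le> exp x ^ k"
    using assms exp_lower_Taylor_quadratic[of x] by (intro power_mono) auto
  then show ?thesis using assms by (simp add: exp_of_nat_mult)
qed

text \<open>The numerical half of the contradiction at \<sigma> = \<open>m\<close>, where
  \<open>\<Phi> m = r\<close>. Since \<open>p\<close> decays exponentially in
  \<open>N * m\<^sup>2\<close>, \<open>r * p\<close> takes at most 2/23 of \<open>1 - a * M\<close>,
  which fits beside \<open>deviation_term_le\<close>.\<close>

lemma error_terms_less_at_mean:
  fixes N :: nat and a m M \<gamma> r p :: real
  defines "r \<equiv> 1 - m\<^sup>2"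
  defines "p \<equiv> sqrt r ^ (N - 1)"
  assumes a: "0 < a" "a < 1" and m: "0 < m" "m < a" "m \<le> M" "M \<le> 1" and N: "8 \<le> N"
    and low: "74/10 * (1 - a * m) \<le> N * (1 - a\<^sup>2) * (a * (2 * m - a))"
    and \<gamma>: "0 \<le> \<gamma>" "\<gamma> \<le> 165/100"
  shows "r * p + (1 - M\<^sup>2) * (N * \<gamma> / m\<^sup>2 * (2 * (1 - p) / (real N - 1) - 2 * (1 - r * p) / (real N + 1)))
    < 1 - a * M"
proof -
  define \<delta> where "\<delta> = 1 - a\<^sup>2"
  \<comment> \<open>\<open>w\<close> measures how far \<open>m\<close> lies below \<open>a\<close>:
    \<open>1 - a * m = \<delta> * (1 + w)\<close>, and
    \<open>1 - a * (2 * m - a) = \<delta> * (1 + 2 * w)\<close>. Keeping \<open>w\<close> in the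
    exponent lets the exponential absorb these factors.\<close>
  define w where "w = a * (a - m) / \<delta>"
  have \<delta>: "0 < \<delta>" using a unfolding \<delta>_def by (simp add: power_less_one_iff)
  have w: "0 \<le> w" unfolding w_def using a m \<delta> by simp
  have \<delta>w: "\<delta> * w = a * a - a * m" unfolding w_def using \<delta> by (simp add: right_diff_distrib[of a])
  have g: "1 - a * m = \<delta> * (1 + w)" using \<delta>w unfolding \<delta>_def by (simp add: algebra_simps power2_eq_square)
  have r: "0 \<le> r" "r \<le> 1" unfolding r_def using a m by (auto simp: power_le_one)
  have rR: "r \<le> \<delta> * (1 + 2 * w)"
  proof -
    have "\<delta> * (1 + 2 * w) - r = (a - m)\<^sup>2"
      using \<delta>w unfolding r_def \<delta>_def by (simp add: algebra_simps power2_eq_square)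
    then show ?thesis using zero_le_power2[of "a - m"] by linarith
  qed
  have p: "0 \<le> p" unfolding p_def using r by simp
  define X where "X = real (N - 1) * (m\<^sup>2 / 2)"
  have X: "32/10 + 32/10 * w \<le> X"
  proof -
    have "\<delta> * (74/10 * (1 + w)) \<le> \<delta> * (N * (a * (2 * m - a)))"
      using low unfolding g \<delta>_def[symmetric] by (simp only: mult_ac)
    then have "74/10 * (1 + w) \<le> N * (a * (2 * m - a))" using \<delta> by (simp only: mult_le_cancel_left_pos)
    also have "\<dots> \<le> N * m\<^sup>2" using zero_le_power2[of "a - m"]
      by (intro mult_left_mono) (auto simp: power2_eq_square algebra_simps)
    finally have "7/8 * (74/10 * (1 + w)) \<le> (7/8 * N) * m\<^sup>2" by linarith
    also have "\<dots> \<le> real (N - 1) * m\<^sup>2" using N by (intro mult_right_mono) auto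
    finally have "7/8 * (74/10 * (1 + w)) \<le> 2 * X" unfolding X_def by simp
    then show ?thesis using w by argo
  qed
  have "sqrt r \<le> exp (- (m\<^sup>2 / 2))"
  proof (rule real_le_lsqrt)
    have "r \<le> exp (- m\<^sup>2)" unfolding r_def using exp_ge_add_one_self[of "- m\<^sup>2"] by simp
    also have "\<dots> = (exp (- (m\<^sup>2 / 2)))\<^sup>2" by (simp flip: exp_of_nat_mult)
    finally show "r \<le> (exp (- (m\<^sup>2 / 2)))\<^sup>2" .
  qed auto
  then have "p \<le> exp (- (m\<^sup>2 / 2)) ^ (N - 1)" unfolding p_def using r by (intro power_mono) auto
  also have "\<dots> = exp (- X)" unfolding X_def by (simp flip: exp_of_nat_mult)
  finally have "p * exp X \<le> 1" by (simp add: exp_minus field_simps)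
  moreover have "23 * (1 + 2 * w) \<le> exp X"
  proof -
    \<comment> \<open>\<open>exp (32/10)\<close> supplies the 23 and \<open>exp (2 * w)\<close> the
      factor \<open>1 + 2 * w\<close>.\<close>
    have "23 \<le> exp (real 10 * (32/100))" by (rule exp_lower_bound_power) (simp_all add: power_divide)
    then have "23 * (1 + 2 * w) \<le> exp (32/10) * exp (2 * w)"
      using w exp_ge_add_one_self[of "2 * w"] by (intro mult_mono) auto
    also have "\<dots> \<le> exp X" using X w by (simp flip: exp_add)
    finally show ?thesis .
  qed
  ultimately have "p * (23 * (1 + 2 * w)) \<le> 1" using p by (meson mult_left_mono order_trans)
  then have "\<delta> * (p * (23 * (1 + 2 * w))) \<le> \<delta> * 1" using \<delta> by (intro mult_left_mono) auto
  moreover have "p * r \<le> p * (\<delta> * (1 + 2 * w))" using rR p by (intro mult_left_mono)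
  ultimately have "23 * (r * p) \<le> \<delta>" by (simp add: algebra_simps)
  also have "\<delta> = (1 - a) * (1 + a)" unfolding \<delta>_def by (simp add: algebra_simps power2_eq_square)
  also have "\<dots> \<le> (1 - a) * 2" using a by (intro mult_left_mono) auto
  also have "\<dots> \<le> 2 * (1 - a * M)" using a m by (auto simp: mult_left_le)
  finally have "r * p \<le> 2/23 * (1 - a * M)" by simp
  moreover have "(1 - M\<^sup>2) * (N * \<gamma> / m\<^sup>2 * (2 * (1 - p) / (real N - 1) - 2 * (1 - r * p) / (real N + 1)))
    \<le> 9061/10000 * (1 - a * M)"
    by (rule deviation_term_le) (use a m N low \<gamma> p r in auto)
  moreover have "0 < 1 - a * M"
  proof -
    have "a * M \<le> a * 1" using a m by (intro mult_left_mono) auto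
    then show ?thesis using a by linarith
  qed
  moreover have "x + y < e" if "x \<le> 2/23 * e" "y \<le> 9061/10000 * e" "0 < e" for x y e :: real
    using that by linarith
  ultimately show ?thesis by blast
qed

text \<open>The numerical half of the contradiction at \<sigma> = \<open>a\<close>, that is for
  \<open>p(0)\<close>, when \<open>m < a\<close>. The third summand is the cost of moving from
  \<open>m\<close> on to \<open>a\<close>. The three shares of \<open>1 - a * M\<close> are 4/100,
  9061/10000 and 528/10000, with sum below 1.\<close>

lemma error_terms_less_at_zero:
  fixes N :: nat and a m M \<gamma> r p \<kappa> R P :: real
  defines "r \<equiv> 1 - m\<^sup>2"
  defines "\<kappa> \<equiv> a * (2 * m - a)"
  defines "R \<equiv> 1 - \<kappa>"
  defines "p \<equiv> sqrt r ^ (N - 1)" and "P \<equiv> sqrt R ^ (N - 1)"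
  assumes a: "3/5 < a" "a < 1" and m: "0 < m" "m < a" "m \<le> M" "M \<le> 1" and N: "8 \<le> N"
    and kap: "0 < \<kappa>"
    and small: "N * (a - m) * (1 + \<kappa>) < 2"
    and low: "74/10 * (1 - a * m) \<le> N * (1 - a\<^sup>2) * (a * (2 * m - a))"
    and \<gamma>: "0 \<le> \<gamma>" "\<gamma> \<le> 165/100"
  shows "R * P + (1 - M\<^sup>2) * (N * \<gamma> / m\<^sup>2 * (2 * (1 - p) / (real N - 1) - 2 * (1 - r * p) / (real N + 1)))
    + (a - m) * (N * sqrt (1 - M\<^sup>2) * \<gamma> * P) < 1 - a * M"
proof -
  define \<delta> where "\<delta> = 1 - a\<^sup>2"
  define w where "w = a * (a - m) / \<delta>"
  have \<delta>: "0 < \<delta>" using a unfolding \<delta>_def by (simp add: power_less_one_iff)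
  have w: "0 \<le> w" unfolding w_def using a m \<delta> by simp
  have \<delta>w: "\<delta> * w = a * a - a * m" unfolding w_def using \<delta> by (simp add: right_diff_distrib[of a])
  have g: "1 - a * m = \<delta> * (1 + w)" using \<delta>w unfolding \<delta>_def by (simp add: algebra_simps power2_eq_square)
  have Rw: "R = \<delta> * (1 + 2 * w)"
    using \<delta>w unfolding R_def \<kappa>_def \<delta>_def by (simp add: algebra_simps power2_eq_square)
  have aM: "0 < 1 - a * M" "1 - a \<le> 1 - a * M"
  proof -
    have "a * M \<le> a * 1" using a m by (intro mult_left_mono) auto
    then show "0 < 1 - a * M" "1 - a \<le> 1 - a * M" using a by linarith+
  qed
  have r: "0 \<le> r" "r \<le> 1" unfolding r_def using a m by (auto simp: power_le_one)
  have R: "0 < R" "R < 1" using Rw \<delta> w kap unfolding R_def by (auto simp: mult_pos_pos add_pos_nonneg)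
  have Nk: "74/10 * (1 + w) \<le> N * \<kappa>"
  proof -
    have "\<delta> * (74/10 * (1 + w)) \<le> \<delta> * (N * \<kappa>)"
      using low unfolding g \<delta>_def[symmetric] \<kappa>_def by (simp only: mult_ac)
    then show ?thesis using \<delta> by (simp only: mult_le_cancel_left_pos)
  qed
  have Nam: "0 \<le> N * (a - m)" using m by simp
  \<comment> \<open>If \<open>\<kappa> < 1/4\<close>, then \<open>small\<close> and
    \<open>Nk\<close> make \<open>a - m\<close> a small multiple of \<open>\<kappa>\<close>; but
    with \<open>m\<close> that close to \<open>a > 3/5\<close>, \<open>\<kappa>\<close> exceeds
    1/4.\<close>
  have k4: "1/4 \<le> \<kappa>"
  proof (rule ccontr)
    assume k: "\<not> 1/4 \<le> \<kappa>"
    have "N * (a - m) < 2" using small Nam kap mult_left_mono[of 1 "1 + \<kappa>" "N * (a - m)"] by simp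
    then have "\<kappa> * (N * (a - m)) \<le> \<kappa> * 2" using kap by (intro mult_left_mono) auto
    moreover have "74/10 * (a - m) \<le> (N * \<kappa>) * (a - m)"
      using Nk w m by (intro mult_right_mono) auto
    moreover have "(N * \<kappa>) * (a - m) = \<kappa> * (N * (a - m))" by (simp only: mult_ac)
    ultimately have "74/10 * (a - m) \<le> 2 * \<kappa>" by linarith
    then have "a * (74/10 * (a - m)) \<le> a * (2 * \<kappa>)" using a by (intro mult_left_mono) auto
    also have "\<dots> \<le> a * (2 * (1/4))" using k a by (intro mult_left_mono) auto
    finally have "74/10 * (a * a - a * m) \<le> a / 2" by (simp add: algebra_simps)
    moreover have "a * a - 2 * (a * a - a * m) = \<kappa>" unfolding \<kappa>_def by (simp add: algebra_simps)
    moreover have "3/5 * a \<le> a * a" using a by (intro mult_right_mono) auto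
    ultimately show False using k a by linarith
  qed
  \<comment> \<open>\<open>q\<close> is \<open>P\<close> without one factor \<open>sqrt R\<close>,
    which the tail estimate treats separately.\<close>
  define q where "q = sqrt R ^ (N - 2)"
  \<comment> \<open>Here \<open>(1 + y) / (1 - y) = 1 / R\<close>, so the Pade bound yields
    \<open>R \<le> exp (- 2 * y)\<close>, sharper than
    \<open>R \<le> exp (- \<kappa>)\<close>.\<close>
  define y where "y = \<kappa> / (2 - \<kappa>)"
  have q0: "0 \<le> q" unfolding q_def using R by simp
  have Pq: "P = sqrt R * q" unfolding P_def q_def using N by (simp flip: power_Suc) (simp add: numeral_2_eq_2 Suc_diff_Suc)
  have k1: "\<kappa> < 1" using R unfolding R_def by simp
  have y: "0 \<le> y" "y \<le> 1" unfolding y_def using kap k1 by (auto simp: field_simps)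
  have "(1 - y) * exp (2 * y) \<le> 1 + (2 - 1) * y + 0 * y\<^sup>2"
    by (rule one_minus_mult_exp_le) (use y in auto)
  then have "(2 - \<kappa>) * ((1 - y) * exp (2 * y)) \<le> (2 - \<kappa>) * (1 + y)" using k1 by (intro mult_left_mono) auto
  moreover have "(2 - \<kappa>) * (1 - y) = 2 * R" "(2 - \<kappa>) * (1 + y) = 2"
    unfolding y_def R_def using k1 by (auto simp: field_simps)
  ultimately have "R * exp (2 * y) \<le> 1" by (simp flip: mult.assoc)
  then have "(sqrt R * exp y)\<^sup>2 \<le> 1\<^sup>2" using R by (simp add: power_mult_distrib flip: exp_of_nat_mult)
  then have "sqrt R * exp y \<le> 1" by (rule power2_le_imp_le) simp
  then have "(sqrt R * exp y) ^ (N - 2) \<le> 1" using R by (intro power_le_one) auto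
  then have qe: "q * exp (real (N - 2) * y) \<le> 1" unfolding q_def by (simp add: power_mult_distrib exp_of_nat_mult)
  have X: "394/100 + 37/10 * w \<le> real (N - 2) * y"
  proof -
    have "1/4 * (194/100 + 37/10 * w) \<le> \<kappa> * (194/100 + 37/10 * w)"
      using k4 w by (intro mult_right_mono) auto
    moreover have "(394/100 + 37/10 * w) * (2 - \<kappa>)
        = 788/100 + 74/10 * w - 2 * \<kappa> - \<kappa> * (194/100 + 37/10 * w)" by (simp add: field_simps)
    ultimately have "(394/100 + 37/10 * w) * (2 - \<kappa>) \<le> 74/10 * (1 + w) - 2 * \<kappa>" using w by argo
    also have "\<dots> \<le> real (N - 2) * \<kappa>" using Nk N by (simp add: of_nat_diff algebra_simps)
    finally show ?thesis unfolding y_def using k1 by (simp add: field_simps)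
  qed
  have "50 * (1 + 2 * w) \<le> exp (real (N - 2) * y)"
  proof -
    have "50 \<le> exp (real 20 * (197/1000))" by (rule exp_lower_bound_power) (simp_all add: power_divide)
    then have "50 * (1 + 2 * w) \<le> exp (394/100) * exp (2 * w)"
      using w exp_ge_add_one_self[of "2 * w"] by (intro mult_mono) auto
    also have "\<dots> = exp (394/100 + 2 * w)" by (simp flip: exp_add)
    also have "\<dots> \<le> exp (real (N - 2) * y)" using X w by (subst exp_le_cancel_iff) linarith
    finally show ?thesis .
  qed
  then have q50: "q * (50 * (1 + 2 * w)) \<le> 1" using q0 qe by (meson mult_left_mono order_trans)
  have "R * P \<le> R * q"
    unfolding Pq using R q0 by (intro mult_left_mono mult_left_le_one_le) auto
  moreover have "\<delta> * (q * (50 * (1 + 2 * w))) \<le> \<delta> * 1" using q50 \<delta> by (intro mult_left_mono) auto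
  then have "50 * (R * q) \<le> \<delta>" unfolding Rw by (simp add: algebra_simps)
  moreover have "\<delta> = (1 - a) * (1 + a)" unfolding \<delta>_def by (simp add: algebra_simps power2_eq_square)
  moreover have "(1 - a) * (1 + a) \<le> (1 - a) * 2" using a by (intro mult_left_mono) auto
  moreover have "x \<le> 4/100 * e" if "x \<le> y" "50 * y \<le> d" "d = u" "u \<le> (1 - a) * 2" "1 - a \<le> e" for x y d u e
    using that by argo
  ultimately have T: "R * P \<le> 4/100 * (1 - a * M)" using aM(2) by blast
  have tail: "(a - m) * (N * sqrt (1 - M\<^sup>2) * \<gamma> * P) \<le> 528/10000 * (1 - a * M)"
  proof -
    have V: "sqrt \<delta> * sqrt (1 - M\<^sup>2) \<le> 1 - a * M"
    proof -
      have "\<delta> * (1 - M\<^sup>2) \<le> (1 - a * M)\<^sup>2"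
        using zero_le_power2[of "a - M"] unfolding \<delta>_def by (simp add: power2_eq_square algebra_simps)
      then show ?thesis using aM by (simp add: real_le_lsqrt flip: real_sqrt_mult)
    qed
    have sR: "sqrt R \<le> sqrt \<delta> * (1 + w)"
      unfolding Rw real_sqrt_mult using \<delta> w
      by (intro mult_left_mono real_le_lsqrt) (auto simp: power2_eq_square algebra_simps)
    \<comment> \<open>With \<open>k4\<close>, \<open>small\<close> improves to
      \<open>N * (a - m) \<le> 8/5\<close>; then
      \<open>8/5 * (165/100) / 50 = 528/10000\<close>.\<close>
    have "(N * (a - m)) * (5/4) \<le> (N * (a - m)) * (1 + \<kappa>)" using Nam k4 by (intro mult_left_mono) auto
    then have Nam2: "N * (a - m) \<le> 8/5" using small by simp
    have "1 - M\<^sup>2 \<ge> 0" using m by (simp add: power_le_one)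
    then have s0: "0 \<le> sqrt (1 - M\<^sup>2)" by simp
    have "(a - m) * (N * sqrt (1 - M\<^sup>2) * \<gamma> * P) = (N * (a - m)) * \<gamma> * (sqrt (1 - M\<^sup>2) * (sqrt R * q))"
      unfolding Pq by (simp add: mult_ac)
    also have "\<dots> \<le> (8/5) * (165/100) * (sqrt (1 - M\<^sup>2) * ((sqrt \<delta> * (1 + w)) * q))"
      using Nam Nam2 \<gamma> s0 sR q0 R \<delta> w by (intro mult_mono mult_nonneg_nonneg) auto
    also have "\<dots> = 264/100 * ((sqrt \<delta> * sqrt (1 - M\<^sup>2)) * ((1 + w) * q))" by (simp add: mult_ac)
    also have "\<dots> \<le> 264/100 * ((1 - a * M) * (1/50))"
    proof (intro mult_left_mono mult_mono)
      have "q * w \<ge> 0" using q0 w by simp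
      then show "(1 + w) * q \<le> 1/50" using q50 by (simp add: algebra_simps)
    qed (use V aM w q0 in auto)
    finally show ?thesis by simp
  qed
  moreover have "(1 - M\<^sup>2) * (N * \<gamma> / m\<^sup>2 * (2 * (1 - p) / (real N - 1) - 2 * (1 - r * p) / (real N + 1)))
    \<le> 9061/10000 * (1 - a * M)"
    by (rule deviation_term_le) (use a m N low \<gamma> r in \<open>auto simp: p_def\<close>)
  moreover have "x + y + z < e" if "x \<le> 4/100 * e" "z \<le> 528/10000 * e" "y \<le> 9061/10000 * e" "0 < e" for x y z e :: real
    using that by linarith
  ultimately show ?thesis using T aM(1) by blast
qed

section \<open>Reciprocal distances to zeros and critical points\<close>

text \<open>AM-GM with an upper bound \<open>c\<close> in place of the mean: multiply
  \<open>t \<le> exp (t - 1)\<close> over all \<open>t = x i / c\<close>.\<close>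

lemma prod_le_mean_power:
  fixes x :: "'a \<Rightarrow> real" and c :: real
  assumes "finite A" "\<And>i. i \<in> A \<Longrightarrow> 0 \<le> x i" "sum x A \<le> card A * c"
  shows "prod x A \<le> c ^ card A"
proof (cases "A = {}")
  case False
  then have card: "0 < card A" using assms by (simp add: card_gt_0_iff)
  have sum0: "0 \<le> sum x A" using assms by (intro sum_nonneg)
  then have "0 \<le> real (card A) * c" using assms by linarith
  then have "0 \<le> c" using card by (simp add: zero_le_mult_iff)
  show ?thesis
  proof (cases "c = 0")
    case True
    then have "sum x A = 0" using assms sum0 by simp
    then have "\<forall>i\<in>A. x i = 0" using assms by (simp add: sum_nonneg_eq_0_iff)
    then have "prod x A = 0" using \<open>A \<noteq> {}\<close> assms(1) by (auto intro: prod_zero)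
    then show ?thesis using True by simp
  next
    case False
    then have c: "0 < c" using \<open>0 \<le> c\<close> by simp
    have "prod x A \<le> (\<Prod>i\<in>A. c * exp (x i / c - 1))"
    proof (intro prod_mono conjI)
      fix i assume "i \<in> A"
      then show "0 \<le> x i" using assms by simp
      have "x i / c \<le> exp (x i / c - 1)" using exp_ge_add_one_self[of "x i / c - 1"] by simp
      then show "x i \<le> c * exp (x i / c - 1)" using c by (simp add: field_simps)
    qed
    also have "\<dots> = c ^ card A * exp (sum x A / c - card A)"
      using assms by (simp add: prod.distrib sum_subtractf sum_divide_distrib flip: exp_sum)
    also have "\<dots> \<le> c ^ card A * 1"
      using c assms by (intro mult_left_mono) (auto simp: field_simps)
    finally show ?thesis by simp
  qed
qed simp

lemma norm_prod_le_sqrt_power: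
  fixes z :: "'a \<Rightarrow> complex" and c :: real
  assumes "finite A" "(\<Sum>i\<in>A. (cmod (z i))\<^sup>2) \<le> card A * c" "0 \<le> c"
  shows "cmod (prod z A) \<le> sqrt c ^ card A"
proof (rule power2_le_imp_le)
  have "(cmod (prod z A))\<^sup>2 = (\<Prod>i\<in>A. (cmod (z i))\<^sup>2)" by (simp add: prod_power_distrib flip: prod_norm)
  also have "\<dots> \<le> c ^ card A" using assms by (intro prod_le_mean_power) auto
  also have "\<dots> = (sqrt c ^ card A)\<^sup>2" using assms by (metis mult.commute power_mult real_sqrt_pow2)
  finally show "(cmod (prod z A))\<^sup>2 \<le> (sqrt c ^ card A)\<^sup>2" .
qed (use assms in simp)

lemma cmod_affine_squared:
  "(cmod (of_real t + of_real s * z))\<^sup>2 = t\<^sup>2 + 2 * t * s * Re z + s\<^sup>2 * (cmod z)\<^sup>2"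
  unfolding cmod_power2 by (simp add: power2_eq_square algebra_simps)

text \<open>The product rule \<open>n \<Prod> (t - \<zeta>\<^sub>j) = \<Prod> (t - z\<^sub>k) + (t - a) \<Sum>\<^sub>k \<Prod>\<^sub>i\<^sub>\<noteq>\<^sub>k (t - z\<^sub>i)\<close> for \<open>p'\<close> at
  \<open>t = a - \<sigma> / \<tau>\<close>, divided by its value at \<open>t = a\<close>; the case \<open>\<tau> = 0\<close> is the point at infinity.\<close>

definition critical_rel :: "nat \<Rightarrow> (nat \<Rightarrow> complex) \<Rightarrow> (nat \<Rightarrow> complex) \<Rightarrow> bool" where
  "critical_rel N w u \<longleftrightarrow> (\<forall>\<tau> \<sigma>. (\<Prod>j<N. \<tau> + \<sigma> * w j) =
    (\<Prod>k<N. \<tau> + \<sigma> * u k) + \<sigma> * (\<Sum>k<N. u k * (\<Prod>i\<in>{..<N}-{k}. \<tau> + \<sigma> * u i)))"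

lemma DERIV_prod_linear:
  fixes w :: "nat \<Rightarrow> complex"
  shows "((\<lambda>\<sigma>. \<Prod>j\<in>A. 1 + \<sigma> * w j) has_field_derivative
    (\<Sum>j\<in>A. w j * (\<Prod>i\<in>A-{j}. 1 + \<sigma> * w i))) (at \<sigma>)"
  by (rule has_field_derivative_prod) (auto intro!: derivative_eq_intros)

text \<open>Compares the coefficients of \<sigma> at \<tau> = 1; both summands on the right
  contribute the sum of the \<open>u k\<close>.\<close>

lemma critical_rel_sum:
  assumes "critical_rel N w u"
  shows "(\<Sum>j<N. w j) = 2 * (\<Sum>k<N. u k)"
proof -
  define G where "G \<sigma> = (\<Sum>k<N. u k * (\<Prod>i\<in>{..<N}-{k}. 1 + \<sigma> * u i))" for \<sigma>
  have "isCont G 0" unfolding G_def by (intro continuous_intros)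
  \<comment> \<open>Caratheodory's criterion: continuity of \<open>G\<close> at 0 suffices.\<close>
  then have "((\<lambda>\<sigma>. \<sigma> * G \<sigma>) has_field_derivative G 0) (at 0)"
    unfolding CARAT_DERIV by (intro exI[of _ G]) auto
  then have "((\<lambda>\<sigma>. (\<Prod>k<N. 1 + \<sigma> * u k) + \<sigma> * G \<sigma>) has_field_derivative
      (\<Sum>k<N. u k * (\<Prod>i\<in>{..<N}-{k}. 1 + 0 * u i)) + G 0) (at 0)"
    by (intro DERIV_add DERIV_prod_linear)
  moreover have "(\<lambda>\<sigma>. (\<Prod>k<N. 1 + \<sigma> * u k) + \<sigma> * G \<sigma>) = (\<lambda>\<sigma>. \<Prod>j<N. 1 + \<sigma> * w j)"
    using assms[unfolded critical_rel_def, rule_format, of 1] unfolding G_def by simp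
  ultimately have "((\<lambda>\<sigma>. \<Prod>j<N. 1 + \<sigma> * w j) has_field_derivative
      (\<Sum>k<N. u k * (\<Prod>i\<in>{..<N}-{k}. 1 + 0 * u i)) + G 0) (at 0)" by simp
  from DERIV_unique[OF DERIV_prod_linear this]
  have "(\<Sum>j<N. w j * (\<Prod>i\<in>{..<N}-{j}. 1 + 0 * w i)) =
     (\<Sum>k<N. u k * (\<Prod>i\<in>{..<N}-{k}. 1 + 0 * u i)) + G 0" .
  then show ?thesis unfolding G_def by simp
qed

text \<open>Bounding the modulus of the second factor by its real part splits the claim into
  \<open>0 \<le> (P - 1) + a * (P * Re (1 / v k) - Re (v k))\<close> for each \<open>k\<close>. This
  follows from \<open>1 \<le> cmod (v k) \<le> P\<close>, since all other factors of
  \<open>P\<close> are at least 1.\<close>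

lemma norm_prod_mult_ge:
  fixes v :: "'a \<Rightarrow> complex"
  assumes "finite A" and v: "\<And>k. k \<in> A \<Longrightarrow> 1 \<le> cmod (v k)" and a: "0 \<le> a" "a \<le> 1"
  shows "card A + 1 + a * (\<Sum>k\<in>A. Re (v k)) \<le> cmod ((\<Prod>k\<in>A. v k) * (card A + 1 + a * (\<Sum>k\<in>A. 1 / v k)))"
proof -
  define P where "P = (\<Prod>k\<in>A. cmod (v k))"
  have le_P: "cmod (v k) \<le> P" if "k \<in> A" for k
  proof -
    have "1 \<le> (\<Prod>k\<in>A-{k}. cmod (v k))"
      using v by (intro prod_ge_1) auto
    then have "cmod (v k) * 1 \<le> cmod (v k) * (\<Prod>k\<in>A-{k}. cmod (v k))"
      by (intro mult_left_mono) auto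
    then show ?thesis using prod.remove[OF assms(1) that, of "\<lambda>k. cmod (v k)"] unfolding P_def by simp
  qed
  have P1: "1 \<le> P" unfolding P_def using v by (intro prod_ge_1) auto
  have "0 \<le> (P - 1) + a * (P * Re (1 / v k) - Re (v k))" if "k \<in> A" for k
  proof -
    define r where "r = cmod (v k)"
    have r: "1 \<le> r" "r \<le> P" unfolding r_def using that v le_P by auto
    have Re: "Re (1 / v k) = Re (v k) / r\<^sup>2"
      unfolding r_def by (simp add: Re_divide cmod_power2)
    have Re2: "P * Re (1 / v k) - Re (v k) = Re (v k) / r\<^sup>2 * (P - r\<^sup>2)"
      unfolding Re using r by (simp add: field_simps)
    have abs: "\<bar>Re (v k) / r\<^sup>2\<bar> \<le> 1 / r"
    proof -
      have "\<bar>Re (v k)\<bar> / r\<^sup>2 \<le> r / r\<^sup>2" unfolding r_def by (intro divide_right_mono abs_Re_le_cmod) auto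
      then show ?thesis using r by (simp add: power2_eq_square)
    qed
    have "1 - P \<le> Re (v k) / r\<^sup>2 * (P - r\<^sup>2)"
    proof (cases "r\<^sup>2 \<le> P")
      case True
      have "1 / r \<le> 1" using r by simp
      then have "-1 \<le> Re (v k) / r\<^sup>2" using abs by linarith
      then have "-1 * (P - r\<^sup>2) \<le> Re (v k) / r\<^sup>2 * (P - r\<^sup>2)" using True by (intro mult_right_mono) auto
      moreover have "1 \<le> r\<^sup>2" using r by simp
      then have "1 - P \<le> -1 * (P - r\<^sup>2)" by simp
      ultimately show ?thesis by (rule order_trans[rotated])
    next
      case False
      have "1 \<le> P / r" using r by simp
      then have "1 - P \<le> P / r - r" using r by linarith
      also have "\<dots> = 1 / r * (P - r\<^sup>2)" using r by (simp add: field_simps power2_eq_square)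
      also have "\<dots> \<le> Re (v k) / r\<^sup>2 * (P - r\<^sup>2)"
        using False abs_le_D1[OF abs] by (intro mult_right_mono_neg) auto
      finally show ?thesis .
    qed
    then have "a * (1 - P) \<le> a * (P * Re (1 / v k) - Re (v k))"
      unfolding Re2 using a by (intro mult_left_mono) auto
    moreover have "1 * (1 - P) \<le> a * (1 - P)" using a P1 by (intro mult_right_mono_neg) auto
    ultimately have "1 * (1 - P) \<le> a * (P * Re (1 / v k) - Re (v k))" by (rule order_trans[rotated])
    then show ?thesis by simp
  qed
  then have "0 \<le> (\<Sum>k\<in>A. (P - 1) + a * (P * Re (1 / v k) - Re (v k)))" by (intro sum_nonneg)
  also have "\<dots> = card A * (P - 1) + a * (P * (\<Sum>k\<in>A. Re (1 / v k)) - (\<Sum>k\<in>A. Re (v k)))"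
    by (simp add: sum.distrib sum_subtractf flip: sum_distrib_left)
  finally have "card A + 1 + a * (\<Sum>k\<in>A. Re (v k)) \<le> P * (card A + 1 + a * (\<Sum>k\<in>A. Re (1 / v k)))"
    using P1 by (simp add: algebra_simps)
  also have "\<dots> \<le> P * cmod (card A + 1 + a * (\<Sum>k\<in>A. 1 / v k))"
  proof (rule mult_left_mono)
    have "card A + 1 + a * (\<Sum>k\<in>A. Re (1 / v k)) = Re (card A + 1 + a * (\<Sum>k\<in>A. 1 / v k))"
      by simp
    then show "card A + 1 + a * (\<Sum>k\<in>A. Re (1 / v k)) \<le> cmod (card A + 1 + a * (\<Sum>k\<in>A. 1 / v k))"
      by (metis complex_Re_le_cmod)
  qed (use P1 in auto)
  finally show ?thesis unfolding P_def by (simp add: norm_mult prod_norm)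
qed

section \<open>The hypothetical counterexample with \<open>a < 1\<close>\<close>

text \<open>\<open>disc\<close> says that the zero \<open>a + 1 / u k\<close> lies in the closed
  unit disk. \<open>sum_sq\<close> includes equality, so refuting the configuration yields a strict
  inequality for \<open>a < 1\<close>.\<close>

locale critical_config =
  fixes N :: nat and w u :: "nat \<Rightarrow> complex" and a :: real
  assumes N: "0 < N" and a: "0 \<le> a" "a < 1"
    and rel: "critical_rel N w u"
    and disc: "\<And>k. k < N \<Longrightarrow> cmod (1 + a * u k) \<le> cmod (u k)"
    and sum_sq: "(\<Sum>j<N. (cmod (w j))\<^sup>2) \<le> N"
begin

definition wm :: complex where "wm = (\<Sum>j<N. w j) / N"
definition m :: real where "m = - Re wm"
definition M :: real where "M = cmod wm"
definition \<kappa> :: real where "\<kappa> = a * (2 * m - a)"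
definition P :: "complex \<Rightarrow> complex" where "P \<sigma> = (\<Prod>j<N. 1 + \<sigma> * w j)"
text \<open>Not a derivative, but \<open>P\<close> with one factor omitted.\<close>

definition P' :: "nat \<Rightarrow> complex \<Rightarrow> complex" where "P' j \<sigma> = (\<Prod>i\<in>{..<N}-{j}. 1 + \<sigma> * w i)"
definition I :: "complex \<Rightarrow> complex" where "I \<sigma> = \<sigma> * (\<Prod>k<N. 1 + \<sigma> * u k)"
definition f :: "complex \<Rightarrow> complex" where "f \<sigma> = (1 + wm * \<sigma>) * P \<sigma> - of_nat (N + 1) * wm * I \<sigma>"
text \<open>By \<open>sum_sq\<close>, an upper bound for the mean of
  \<open>(cmod (1 + s * w j))\<^sup>2\<close>.\<close>

definition \<Phi> :: "real \<Rightarrow> real" where "\<Phi> s = 1 - 2 * m * s + s\<^sup>2"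

lemma sum_w: "(\<Sum>j<N. w j) = N * wm"
  using N by (simp add: wm_def)

lemma sum_Re_w: "(\<Sum>j<N. Re (w j)) = - (N * m)"
  using arg_cong[OF sum_w, of Re] by (simp add: m_def)

lemma sum_Re_u: "(\<Sum>j<N. Re (u j)) = - (N * m / 2)"
  using arg_cong[OF critical_rel_sum[OF rel], of Re] sum_Re_w by simp

lemma sum_cmod_affine:
  "(\<Sum>j<N. (cmod (of_real t + of_real s * w j))\<^sup>2) \<le> N * (t\<^sup>2 - 2 * m * t * s + s\<^sup>2)"
proof -
  have "(\<Sum>j<N. (cmod (of_real t + of_real s * w j))\<^sup>2)
    = N * t\<^sup>2 + 2 * t * s * (\<Sum>j<N. Re (w j)) + s\<^sup>2 * (\<Sum>j<N. (cmod (w j))\<^sup>2)"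
    unfolding cmod_affine_squared by (simp add: sum.distrib sum_distrib_left)
  also have "\<dots> \<le> N * t\<^sup>2 + 2 * t * s * (\<Sum>j<N. Re (w j)) + s\<^sup>2 * N"
    using sum_sq by (intro add_left_mono mult_left_mono) auto
  finally show ?thesis unfolding sum_Re_w by (simp add: algebra_simps)
qed

lemma affine_nonneg: "0 \<le> t\<^sup>2 - 2 * m * t * s + s\<^sup>2"
proof -
  have "0 \<le> N * (t\<^sup>2 - 2 * m * t * s + s\<^sup>2)"
    by (rule order_trans[OF sum_nonneg sum_cmod_affine]) auto
  then show ?thesis using N by (simp add: zero_le_mult_iff)
qed

lemma norm_prod_affine:
  "cmod (\<Prod>j<N. of_real t + of_real s * w j) \<le> sqrt (t\<^sup>2 - 2 * m * t * s + s\<^sup>2) ^ N"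
  using norm_prod_le_sqrt_power[of "{..<N}" "\<lambda>j. of_real t + of_real s * w j"]
    sum_cmod_affine[of t s] affine_nonneg[of t s] by simp

text \<open>For the zero \<open>z = a + 1 / u k\<close> this is
  \<open>cmod (z - c) \<le> cmod (1 - c * z)\<close> multiplied by
  \<open>cmod (u k)\<close>.\<close>

lemma moebius_bound:
  assumes "k < N" "0 \<le> c" "c \<le> a"
  shows "cmod (1 + of_real (a - c) * u k) \<le> cmod (of_real (1 - a * c) * u k - of_real c)"
proof (rule power2_le_imp_le)
  define x y where "x = Re (u k)" and "y = Im (u k)"
  have "(cmod (1 + a * u k))\<^sup>2 \<le> (cmod (u k))\<^sup>2" using disc assms by (intro power_mono) auto
  then have "(1 + a * x)\<^sup>2 + (a * y)\<^sup>2 \<le> x\<^sup>2 + y\<^sup>2" unfolding x_def y_def by (simp add: cmod_power2)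
  moreover have "0 \<le> 1 - c\<^sup>2" using assms a by (simp add: power_le_one)
  ultimately have "0 \<le> (1 - c\<^sup>2) * (x\<^sup>2 + y\<^sup>2 - ((1 + a * x)\<^sup>2 + (a * y)\<^sup>2))" by simp
  also have "\<dots> = (((1 - a * c) * x - c)\<^sup>2 + ((1 - a * c) * y)\<^sup>2) - ((1 + (a - c) * x)\<^sup>2 + ((a - c) * y)\<^sup>2)"
    by (simp add: algebra_simps power2_eq_square)
  also have "\<dots> = (cmod (of_real (1 - a * c) * u k - of_real c))\<^sup>2 - (cmod (1 + of_real (a - c) * u k))\<^sup>2"
    unfolding x_def y_def by (simp add: cmod_power2)
  finally show "(cmod (1 + of_real (a - c) * u k))\<^sup>2 \<le> (cmod (of_real (1 - a * c) * u k - of_real c))\<^sup>2" by simp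
qed simp

lemma u_nz: "k < N \<Longrightarrow> u k \<noteq> 0"
  using disc[of k] by auto

text \<open>Writes the right side of \<open>critical_rel\<close> as a product times a logarithmic
  derivative. With \<open>s = 1 - a * c\<close> it concerns \<open>p'\<close> at
  \<open>1 / c\<close>, or at infinity if \<open>c = 0\<close>.\<close>

lemma rel_shift:
  assumes "\<And>k. k < N \<Longrightarrow> of_real s * u k - of_real c \<noteq> 0"
  shows "(\<Prod>j<N. of_real (- c) + of_real s * w j) =
    (\<Prod>k<N. of_real s * u k - of_real c) * (1 + (\<Sum>k<N. of_real s * u k / (of_real s * u k - of_real c)))"
proof -
  have eq: "(\<Prod>i\<in>{..<N}-{k}. of_real s * u i - of_real c) = (\<Prod>i<N. of_real s * u i - of_real c) / (of_real s * u k - of_real c)"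
    if "k < N" for k
    using that assms[OF that] prod.remove[of "{..<N}" k "\<lambda>i. of_real s * u i - of_real c"] by simp
  have "(\<Prod>j<N. of_real (- c) + of_real s * w j) = (\<Prod>k<N. of_real s * u k - of_real c) +
    of_real s * (\<Sum>k<N. u k * (\<Prod>i\<in>{..<N}-{k}. of_real s * u i - of_real c))"
    using rel[unfolded critical_rel_def, rule_format, of "of_real (- c)" "of_real s"] by simp
  also have "(\<Sum>k<N. u k * (\<Prod>i\<in>{..<N}-{k}. of_real s * u i - of_real c))
    = (\<Sum>k<N. u k * ((\<Prod>i<N. of_real s * u i - of_real c) / (of_real s * u k - of_real c)))"
    by (intro sum.cong refl) (simp add: eq)
  also have "of_real s * \<dots> = (\<Prod>k<N. of_real s * u k - of_real c) * (\<Sum>k<N. of_real s * u k / (of_real s * u k - of_real c))"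
    unfolding sum_distrib_left by (intro sum.cong refl) simp
  finally show ?thesis by (simp only: distrib_left mult_1_right)
qed

lemma m_le_M: "m \<le> M"
  using abs_Re_le_cmod[of wm] unfolding m_def M_def by linarith

text \<open>Variance identity: the sum of squared deviations is the sum of squares minus
  \<open>N * M\<^sup>2\<close>; its nonnegativity bounds \<open>M\<close>.\<close>

lemma M_le_1: "M \<le> 1" and sum_dev: "(\<Sum>j<N. (cmod (w j - wm))\<^sup>2) \<le> N * (1 - M\<^sup>2)"
proof -
  have expand: "(cmod (z - wm))\<^sup>2 = (cmod z)\<^sup>2 - 2 * (Re wm * Re z + Im wm * Im z) + M\<^sup>2" for z
    unfolding M_def cmod_power2 by (simp add: power2_eq_square algebra_simps)
  have "(\<Sum>j<N. (cmod (w j - wm))\<^sup>2) = (\<Sum>j<N. (cmod (w j))\<^sup>2)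
     - 2 * (Re wm * Re (\<Sum>j<N. w j) + Im wm * Im (\<Sum>j<N. w j)) + N * M\<^sup>2"
    unfolding expand by (simp add: sum.distrib sum_subtractf flip: sum_distrib_left)
  also have "\<dots> = (\<Sum>j<N. (cmod (w j))\<^sup>2) - N * M\<^sup>2"
    unfolding sum_w M_def cmod_power2 by (simp add: power2_eq_square algebra_simps)
  also have "\<dots> \<le> N * (1 - M\<^sup>2)" using sum_sq by (simp add: algebra_simps)
  finally show *: "(\<Sum>j<N. (cmod (w j - wm))\<^sup>2) \<le> N * (1 - M\<^sup>2)" .
  have "0 \<le> N * (1 - M\<^sup>2)" by (rule order_trans[OF sum_nonneg *]) auto
  then have "M\<^sup>2 \<le> 1\<^sup>2" using N by (simp add: zero_le_mult_iff)
  then show "M \<le> 1" by (rule power2_le_imp_le) simp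
qed

text \<open>Both sides bound the size of \<open>p'\<close> at the inverse point \<open>1 / a\<close>.\<close>

lemma outer_bound:
  fixes b \<delta> :: real
  assumes "b = 1 - a * m / 2" "\<delta> = 1 - a\<^sup>2"
  shows "1 + N * \<delta> * b \<le> sqrt (1 + \<delta> * \<kappa>) ^ N" "0 \<le> 1 + \<delta> * \<kappa>"
proof -
  have aa: "a * a < 1" using a mult_strict_mono[of a 1 a 1] by simp
  define v where "v k = of_real \<delta> * u k - of_real a" for k
  \<comment> \<open>\<open>v k\<close> is \<open>u k * (1 - a * z)\<close> for the zero
    \<open>z\<close>; the case \<open>c = a\<close> of \<open>moebius_bound\<close> has left side
    1.\<close>
  have v: "1 \<le> cmod (v k)" if "k < N" for k
    using moebius_bound[OF that a(1) order_refl] unfolding v_def assms by (simp add: power2_eq_square)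
  have v0: "v k \<noteq> 0" if "k < N" for k using v[OF that] by auto
  have "\<delta> * u k / v k = 1 + a * (1 / v k)" if "k < N" for k
    using v0[OF that] by (simp add: field_simps v_def)
  then have "1 + (\<Sum>k<N. of_real \<delta> * u k / v k) = 1 + (\<Sum>k<N. 1 + a * (1 / v k))"
    by (intro arg_cong2[where f = "(+)"] sum.cong) auto
  also have "\<dots> = card {..<N} + 1 + a * (\<Sum>k<N. 1 / v k)"
    by (simp add: sum.distrib sum_distrib_left)
  finally have eq: "1 + (\<Sum>k<N. of_real \<delta> * u k / v k) = card {..<N} + 1 + a * (\<Sum>k<N. 1 / v k)" .
  have "(\<Sum>k<N. Re (v k)) = \<delta> * (\<Sum>k<N. Re (u k)) - N * a"
    unfolding v_def by (simp add: sum_subtractf sum_distrib_left)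
  then have Re_v: "(\<Sum>k<N. Re (v k)) = \<delta> * - (N * m / 2) - N * a" unfolding sum_Re_u .
  have "1 + N * \<delta> * b = card {..<N} + 1 + a * (\<Sum>k<N. Re (v k))"
    unfolding Re_v unfolding assms by (simp add: field_simps power2_eq_square)
  also have "\<dots> \<le> cmod ((\<Prod>k<N. v k) * (card {..<N} + 1 + a * (\<Sum>k<N. 1 / v k)))"
    by (rule norm_prod_mult_ge) (use v a in auto)
  also have "\<dots> = cmod (\<Prod>j<N. of_real (- a) + of_real \<delta> * w j)"
    using rel_shift[of \<delta> a] v0 unfolding eq[symmetric] by (simp add: v_def)
  also have "\<dots> \<le> sqrt ((-a)\<^sup>2 - 2 * m * (-a) * \<delta> + \<delta>\<^sup>2) ^ N" by (rule norm_prod_affine)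
  also have q: "(-a)\<^sup>2 - 2 * m * (-a) * \<delta> + \<delta>\<^sup>2 = 1 + \<delta> * \<kappa>"
    unfolding \<kappa>_def assms by (simp add: algebra_simps power2_eq_square)
  finally show "1 + N * \<delta> * b \<le> sqrt (1 + \<delta> * \<kappa>) ^ N" .
  show "0 \<le> 1 + \<delta> * \<kappa>" using affine_nonneg[of "-a" \<delta>] unfolding q .
qed

text \<open>\<open>I (a - c)\<close> is a multiple of \<open>p(c)\<close>. It is compared with \<open>p'\<close> at the reflected point
  \<open>1 / c\<close> via \<open>\<bar>z - c\<bar> \<le> \<bar>1 - c z\<bar>\<close>.\<close>

lemma inner_bound:
  assumes c: "0 \<le> c" "c < a"
  shows "(N + 1) * cmod (I (of_real (a - c))) \<le>
    (a - c) * ((1 + c) / (1 - a * c)) * sqrt (c\<^sup>2 + 2 * m * c * (1 - a * c) + (1 - a * c)\<^sup>2) ^ N"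
proof -
  define s where "s = 1 - a * c"
  define v where "v k = of_real s * u k - of_real c" for k
  have ac: "0 \<le> a * c" "a * c < 1" "c < 1"
    using c a mult_strict_mono[of a 1 c 1] by (auto intro: mult_nonneg_nonneg)
  then have s: "0 < s" "s \<le> 1" unfolding s_def by auto
  \<comment> \<open>\<open>v k = 0\<close> would place a zero at \<open>1 / c\<close> (at infinity
    for \<open>c = 0\<close>), outside the disk.\<close>
  have v0: "v k \<noteq> 0" if "k < N" for k
  proof
    assume "v k = 0"
    then have uk: "u k = of_real (c / s)" unfolding v_def using s by (simp add: field_simps)
    have "1 + a * u k = of_real (1 + a * (c / s))" unfolding uk by simp
    then have "cmod (1 + a * u k) = \<bar>1 + a * (c / s)\<bar>" by (simp only: norm_of_real)
    moreover have "0 \<le> a * (c / s)" using a c s by (intro mult_nonneg_nonneg divide_nonneg_nonneg) auto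
    moreover have "cmod (u k) = c / s" unfolding uk norm_of_real using c s by simp
    ultimately have "1 + a * (c / s) \<le> c / s" using disc[OF that] by linarith
    then have "(1 + a * (c / s)) * s \<le> (c / s) * s" using s by (intro mult_right_mono) auto
    then have "s + a * c \<le> c" using s by (simp add: distrib_right)
    then show False using ac unfolding s_def by simp
  qed
  \<comment> \<open>\<open>q\<close> lies in the disk of radius \<open>c < 1\<close> about 1, and
    inversion maps that disk into the half-plane of real part at least
    \<open>1 / (1 + c)\<close>.\<close>
  have Re_ge: "s / (1 + c) \<le> Re (of_real s * u k / v k)" if "k < N" for k
  proof -
    define q where "q = v k / u k"
    have uk: "u k \<noteq> 0" using u_nz that by simp
    have q0: "q \<noteq> 0" unfolding q_def using uk v0[OF that] by simp
    have qz: "q - 1 = - of_real c * ((1 + a * u k) / u k)"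
      unfolding q_def v_def s_def using uk by (simp add: field_simps)
    have "cmod ((1 + a * u k) / u k) \<le> 1" using disc[OF that] uk by (simp add: norm_divide)
    moreover have "cmod (q - 1) = c * cmod ((1 + a * u k) / u k)"
      unfolding qz by (simp only: norm_mult norm_minus_cancel norm_of_real abs_of_nonneg[OF c(1)])
    ultimately have q1: "cmod (q - 1) \<le> c" using c by (simp only: mult_left_le)
    then have qc: "cmod q \<le> 1 + c" using norm_triangle_ineq[of "q - 1" 1] by simp
    have "(cmod (q - 1))\<^sup>2 \<le> c\<^sup>2" using q1 by (intro power_mono) auto
    then have "(cmod q)\<^sup>2 - 2 * Re q + 1 \<le> c\<^sup>2"
      unfolding cmod_power2 by (simp add: power2_eq_square algebra_simps)
    moreover have "(1 - c) * (cmod q)\<^sup>2 \<le> (1 - c) * ((1 + c)\<^sup>2)" using qc ac by (intro mult_left_mono power_mono) auto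
    then have "2 * (cmod q)\<^sup>2 \<le> (1 + c) * ((cmod q)\<^sup>2 + 1 - c\<^sup>2)" by (simp add: power2_eq_square algebra_simps)
    ultimately have "2 * (cmod q)\<^sup>2 \<le> (1 + c) * (2 * Re q)"
      using c by (elim order_trans) (intro mult_left_mono, auto)
    then have "1 / (1 + c) \<le> Re q / (cmod q)\<^sup>2" using c q0 by (simp add: field_simps)
    also have "\<dots> = Re (1 / q)" by (simp add: Re_divide cmod_power2)
    finally have "s * (1 / (1 + c)) \<le> s * Re (1 / q)" using s by (intro mult_left_mono) auto
    also have "\<dots> = Re (of_real s * (1 / q))"
      by (simp only: times_complex.sel Re_complex_of_real Im_complex_of_real)
    finally show ?thesis unfolding q_def by simp
  qed
  define x where "x = s / (1 + c)"
  have x: "0 < x" "x \<le> 1" unfolding x_def using s c by auto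
  have "1 + N * x \<le> 1 + (\<Sum>k<N. Re (of_real s * u k / v k))"
    using sum_mono[of "{..<N}" "\<lambda>k. x"] Re_ge unfolding x_def by simp
  also have "\<dots> = Re (1 + (\<Sum>k<N. of_real s * u k / v k))" by simp
  also have "\<dots> \<le> cmod (1 + (\<Sum>k<N. of_real s * u k / v k))" by (rule complex_Re_le_cmod)
  finally have big: "1 + N * x \<le> cmod (1 + (\<Sum>k<N. of_real s * u k / v k))" .
  have "(N + 1) * x \<le> 1 + N * x" using x by (simp add: algebra_simps)
  then have big': "(N + 1) * x \<le> cmod (1 + (\<Sum>k<N. of_real s * u k / v k))" using big by linarith
  define Q where "Q = (\<Prod>k<N. cmod (v k))"
  have Q: "0 \<le> Q" unfolding Q_def by (intro prod_nonneg) auto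
  have "cmod (\<Prod>k<N. 1 + of_real (a - c) * u k) \<le> Q"
    unfolding Q_def prod_norm[symmetric] v_def s_def using c
    by (intro prod_mono conjI moebius_bound) auto
  then have "(N + 1) * cmod (I (of_real (a - c))) \<le> (N + 1) * ((a - c) * Q)"
  proof -
    assume *: "cmod (\<Prod>k<N. 1 + of_real (a - c) * u k) \<le> Q"
    have "cmod (I (of_real (a - c))) = (a - c) * cmod (\<Prod>k<N. 1 + of_real (a - c) * u k)"
      unfolding I_def norm_mult norm_of_real using c by simp
    also have "\<dots> \<le> (a - c) * Q" using * c by (intro mult_left_mono) auto
    finally show ?thesis by (intro mult_left_mono) auto
  qed
  also have "\<dots> = (a - c) / x * (((N + 1) * x) * Q)" using x by simp
  also have "\<dots> \<le> (a - c) / x * (cmod (1 + (\<Sum>k<N. of_real s * u k / v k)) * Q)"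
    using c x Q big' by (intro mult_left_mono mult_right_mono) auto
  also have "cmod (1 + (\<Sum>k<N. of_real s * u k / v k)) * Q = cmod (\<Prod>j<N. of_real (- c) + of_real s * w j)"
    using rel_shift[of s c] v0 unfolding Q_def by (simp add: v_def norm_mult prod_norm mult.commute)
  also have "(a - c) / x * \<dots> \<le> (a - c) / x * sqrt ((-c)\<^sup>2 - 2 * m * (-c) * s + s\<^sup>2) ^ N"
    using c x by (intro mult_left_mono norm_prod_affine) auto
  finally show ?thesis unfolding x_def s_def by simp
qed

section \<open>The auxiliary function \<open>f\<close> and its deviation from 1\<close>

lemma \<Phi>_alt: "\<Phi> s = (s - m)\<^sup>2 + (1 - m\<^sup>2)"
  unfolding \<Phi>_def by (simp add: power2_eq_square algebra_simps)

lemma \<Phi>_nonneg: "0 \<le> \<Phi> s"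
  using affine_nonneg[of 1 s] unfolding \<Phi>_def by simp

lemma norm_P: "cmod (P (of_real s)) \<le> sqrt (\<Phi> s) ^ N"
  using norm_prod_affine[of 1 s] unfolding P_def \<Phi>_def by simp

text \<open>The loss in AM-GM when one factor is omitted: the squares of \<open>N - 1\<close>
  factors are bounded by the full total \<open>N * \<Phi> s\<close>.\<close>

definition \<gamma> :: real where "\<gamma> = sqrt (N / (N - 1)) ^ (N - 1)"

lemma norm_P':
  assumes "2 \<le> N" "j < N"
  shows "cmod (P' j (of_real s)) \<le> \<gamma> * sqrt (\<Phi> s) ^ (N - 1)"
proof -
  have "(\<Sum>i\<in>{..<N}-{j}. (cmod (1 + of_real s * w i))\<^sup>2) \<le> (\<Sum>i<N. (cmod (1 + of_real s * w i))\<^sup>2)"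
    by (intro sum_mono2) auto
  also have "\<dots> \<le> N * \<Phi> s" using sum_cmod_affine[of 1 s] unfolding \<Phi>_def by simp
  also have "\<dots> = card ({..<N}-{j}) * (N / (N - 1) * \<Phi> s)" using assms by simp
  finally have "cmod (P' j (of_real s)) \<le> sqrt (N / (N - 1) * \<Phi> s) ^ card ({..<N}-{j})"
    unfolding P'_def using \<Phi>_nonneg[of s] by (intro norm_prod_le_sqrt_power) auto
  moreover have "card ({..<N}-{j}) = N - 1" using assms by simp
  ultimately show ?thesis unfolding \<gamma>_def by (simp only: real_sqrt_mult power_mult_distrib)
qed

lemma norm_wm_factor: "(cmod (1 + wm * of_real s))\<^sup>2 = \<Phi> s - s\<^sup>2 * (1 - M\<^sup>2)"
  using cmod_affine_squared[of 1 s wm] unfolding \<Phi>_def m_def M_def by (simp add: algebra_simps)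

text \<open>\<open>critical_rel\<close> at \<tau> = 1 says that \<open>I\<close> has derivative
  \<open>P\<close>; the rest follows by distributing \<open>N * wm * P\<close> over the
  \<open>N\<close> factorizations of \<open>P\<close>.\<close>

lemma DERIV_f: "(f has_field_derivative (\<Sum>j<N. (w j - wm) * P' j \<sigma>)) (at \<sigma>)"
proof -
  have P: "(P has_field_derivative (\<Sum>j<N. w j * P' j \<sigma>)) (at \<sigma>)"
    unfolding P_def P'_def by (rule DERIV_prod_linear)
  have "(I has_field_derivative 1 * (\<Prod>k<N. 1 + \<sigma> * u k) + (\<Sum>k<N. u k * (\<Prod>i\<in>{..<N}-{k}. 1 + \<sigma> * u i)) * \<sigma>) (at \<sigma>)"
    unfolding I_def by (rule DERIV_mult[OF DERIV_ident DERIV_prod_linear])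
  then have I: "(I has_field_derivative P \<sigma>) (at \<sigma>)"
    using rel[unfolded critical_rel_def, rule_format, of 1 \<sigma>] unfolding P_def by (simp add: mult.commute)
  have f: "(f has_field_derivative wm * P \<sigma> + (\<Sum>j<N. w j * P' j \<sigma>) * (1 + wm * \<sigma>) - of_nat (N + 1) * wm * P \<sigma>) (at \<sigma>)"
    unfolding f_def
    by (intro DERIV_diff DERIV_mult P DERIV_cmult I) (auto intro!: derivative_eq_intros)
  have PP: "P \<sigma> = (1 + \<sigma> * w j) * P' j \<sigma>" if "j < N" for j
    unfolding P_def P'_def using that prod.remove[of "{..<N}" j "\<lambda>i. 1 + \<sigma> * w i"] by simp
  have "of_nat N * wm * P \<sigma> = (\<Sum>j<N. wm * P \<sigma>)" by simp
  also have "\<dots> = (\<Sum>j<N. wm * ((1 + \<sigma> * w j) * P' j \<sigma>))" by (intro sum.cong refl) (use PP in auto)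
  finally have "(\<Sum>j<N. w j * P' j \<sigma>) * (1 + wm * \<sigma>) - of_nat N * wm * P \<sigma>
    = (\<Sum>j<N. w j * P' j \<sigma> * (1 + wm * \<sigma>) - wm * ((1 + \<sigma> * w j) * P' j \<sigma>))"
    by (simp add: sum_subtractf sum_distrib_right)
  also have "\<dots> = (\<Sum>j<N. (w j - wm) * P' j \<sigma>)" by (intro sum.cong refl) (simp add: algebra_simps)
  finally have "wm * P \<sigma> + (\<Sum>j<N. w j * P' j \<sigma>) * (1 + wm * \<sigma>) - of_nat (N + 1) * wm * P \<sigma> = (\<Sum>j<N. (w j - wm) * P' j \<sigma>)"
    by (simp add: algebra_simps)
  with f show ?thesis by simp
qed

text \<open>Since \<open>1 + wm * \<sigma> = (1 + \<sigma> * w j) - \<sigma> * (w j - wm)\<close>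
  and the deviations sum to 0, the first-order terms cancel, which gains a factor \<sigma> and
  squared deviations.\<close>

lemma f'_identity:
  "(1 + wm * \<sigma>) * (\<Sum>j<N. (w j - wm) * P' j \<sigma>) = - \<sigma> * (\<Sum>j<N. (w j - wm)\<^sup>2 * P' j \<sigma>)"
proof -
  have PP: "P \<sigma> = (1 + \<sigma> * w j) * P' j \<sigma>" if "j < N" for j
    unfolding P_def P'_def using that prod.remove[of "{..<N}" j "\<lambda>i. 1 + \<sigma> * w i"] by simp
  have "(1 + wm * \<sigma>) * (\<Sum>j<N. (w j - wm) * P' j \<sigma>)
      = (\<Sum>j<N. (w j - wm) * ((1 + \<sigma> * w j) * P' j \<sigma>) - \<sigma> * ((w j - wm)\<^sup>2 * P' j \<sigma>))"
    unfolding sum_distrib_left by (intro sum.cong refl) (simp add: algebra_simps power2_eq_square)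
  also have "\<dots> = (\<Sum>j<N. (w j - wm) * P \<sigma> - \<sigma> * ((w j - wm)\<^sup>2 * P' j \<sigma>))"
    by (intro sum.cong refl) (use PP in auto)
  also have "\<dots> = (\<Sum>j<N. w j - wm) * P \<sigma> - \<sigma> * (\<Sum>j<N. (w j - wm)\<^sup>2 * P' j \<sigma>)"
    by (simp only: sum_distrib_right sum_distrib_left sum_subtractf[symmetric])
  also have "(\<Sum>j<N. w j - wm) = 0" by (simp add: sum_subtractf sum_w)
  finally show ?thesis by simp
qed

text \<open>Cauchy-Schwarz on the deviations. It avoids dividing by \<open>1 + wm * s\<close>, so it
  remains available beyond \<open>s = m\<close>.\<close>

lemma f'_bound_tail:
  assumes "2 \<le> N"
  shows "cmod (\<Sum>j<N. (w j - wm) * P' j (of_real s)) \<le> N * sqrt (1 - M\<^sup>2) * \<gamma> * sqrt (\<Phi> s) ^ (N - 1)"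
proof -
  have B: "0 \<le> \<gamma> * sqrt (\<Phi> s) ^ (N - 1)" unfolding \<gamma>_def using \<Phi>_nonneg[of s] by simp
  have "cmod (\<Sum>j<N. (w j - wm) * P' j (of_real s)) \<le> (\<Sum>j<N. cmod (w j - wm) * (\<gamma> * sqrt (\<Phi> s) ^ (N - 1)))"
    by (intro order_trans[OF norm_sum] sum_mono) (use assms norm_P' in \<open>auto simp: norm_mult intro!: mult_left_mono\<close>)
  also have "\<dots> = (\<Sum>j<N. cmod (w j - wm)) * (\<gamma> * sqrt (\<Phi> s) ^ (N - 1))" by (simp flip: sum_distrib_right)
  also have "\<dots> \<le> (N * sqrt (1 - M\<^sup>2)) * (\<gamma> * sqrt (\<Phi> s) ^ (N - 1))"
  proof (rule mult_right_mono[OF _ B])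
    have V: "0 \<le> 1 - M\<^sup>2" using M_le_1 unfolding M_def by (simp add: power_le_one)
    have "(\<Sum>j<N. cmod (w j - wm) * 1)\<^sup>2 \<le> (\<Sum>j<N. (cmod (w j - wm))\<^sup>2) * (\<Sum>j<N. 1\<^sup>2)"
      by (rule Cauchy_Schwarz_ineq_sum)
    also have "\<dots> \<le> (N * (1 - M\<^sup>2)) * N" using sum_dev by (simp add: mult_right_mono)
    also have "\<dots> = (N * sqrt (1 - M\<^sup>2))\<^sup>2" using V by (simp add: power_mult_distrib power2_eq_square)
    finally have "(\<Sum>j<N. cmod (w j - wm))\<^sup>2 \<le> (N * sqrt (1 - M\<^sup>2))\<^sup>2" by simp
    then show "(\<Sum>j<N. cmod (w j - wm)) \<le> N * sqrt (1 - M\<^sup>2)" by (rule power2_le_imp_le) (use V in simp)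
  qed
  finally show ?thesis by (simp add: mult.assoc)
qed

text \<open>Divides \<open>f'_identity\<close> by \<open>cmod (1 + wm * s)\<close>, which is at
  least \<open>\<Phi> s\<close> for \<open>s \<le> m\<close>; this lowers the exponent from
  \<open>N - 1\<close> to \<open>N - 3\<close>.\<close>

lemma f'_bound_main:
  assumes "3 \<le> N" "0 \<le> s" "s \<le> m" "s < 1"
  shows "cmod (\<Sum>j<N. (w j - wm) * P' j (of_real s)) \<le> (1 - M\<^sup>2) * (N * \<gamma>) * (s * sqrt (\<Phi> s) ^ (N - 3))"
proof -
  define F where "F = cmod (\<Sum>j<N. (w j - wm) * P' j (of_real s))"
  have m0: "0 \<le> m" "m \<le> 1" using assms m_le_M M_le_1 by auto
  have V: "0 \<le> 1 - M\<^sup>2" using M_le_1 unfolding M_def by (simp add: power_le_one)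
  have pos: "0 < \<Phi> s"
  proof (cases "m < 1")
    case True
    then have "m\<^sup>2 < 1" using m0 by (simp add: power_less_one_iff)
    then show ?thesis unfolding \<Phi>_alt by (simp add: add_nonneg_pos)
  next
    case False
    then have "m = 1" using m0 by simp
    then show ?thesis unfolding \<Phi>_alt using assms by simp
  qed
  have "(\<Phi> s)\<^sup>2 \<le> (1 - s\<^sup>2) * \<Phi> s"
  proof -
    have "s * s \<le> m * s" using assms by (intro mult_right_mono) auto
    then have "\<Phi> s \<le> 1 - s\<^sup>2" unfolding \<Phi>_def by (simp add: power2_eq_square)
    then show ?thesis using pos by (simp add: power2_eq_square mult_right_mono)
  qed
  also have "\<dots> \<le> \<Phi> s - s\<^sup>2 * (1 - M\<^sup>2)"
  proof -
    have "m\<^sup>2 \<le> M\<^sup>2" using m_le_M m0 by (intro power_mono) auto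
    then have "1 - M\<^sup>2 \<le> \<Phi> s" unfolding \<Phi>_alt by (simp add: add_increasing)
    then have "s\<^sup>2 * (1 - M\<^sup>2) \<le> s\<^sup>2 * \<Phi> s" by (intro mult_left_mono) auto
    then show ?thesis by (simp add: algebra_simps)
  qed
  finally have "(\<Phi> s)\<^sup>2 \<le> (cmod (1 + wm * of_real s))\<^sup>2" unfolding norm_wm_factor .
  then have A: "\<Phi> s \<le> cmod (1 + wm * of_real s)" by (rule power2_le_imp_le) simp
  have "cmod (\<Sum>j<N. (w j - wm)\<^sup>2 * P' j (of_real s)) \<le> (\<Sum>j<N. (cmod (w j - wm))\<^sup>2 * (\<gamma> * sqrt (\<Phi> s) ^ (N - 1)))"
    by (intro order_trans[OF norm_sum] sum_mono) (use assms norm_P' in \<open>auto simp: norm_mult norm_power intro!: mult_left_mono\<close>)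
  also have "\<dots> = (\<Sum>j<N. (cmod (w j - wm))\<^sup>2) * (\<gamma> * sqrt (\<Phi> s) ^ (N - 1))" by (simp flip: sum_distrib_right)
  also have "\<dots> \<le> (N * (1 - M\<^sup>2)) * (\<gamma> * sqrt (\<Phi> s) ^ (N - 1))"
    using sum_dev pos unfolding \<gamma>_def by (intro mult_right_mono) auto
  also have "sqrt (\<Phi> s) ^ (N - 1) = \<Phi> s * sqrt (\<Phi> s) ^ (N - 3)"
  proof -
    have "N - 1 = 2 + (N - 3)" using assms by simp
    then show ?thesis using pos by (simp only: power_add) simp
  qed
  finally have B: "cmod (\<Sum>j<N. (w j - wm)\<^sup>2 * P' j (of_real s))
    \<le> (N * (1 - M\<^sup>2)) * (\<gamma> * (\<Phi> s * sqrt (\<Phi> s) ^ (N - 3)))" .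
  have "\<Phi> s * F \<le> cmod (1 + wm * of_real s) * F" using A unfolding F_def by (intro mult_right_mono) auto
  also have "\<dots> = s * cmod (\<Sum>j<N. (w j - wm)\<^sup>2 * P' j (of_real s))"
    unfolding F_def norm_mult[symmetric] f'_identity using assms by (simp add: norm_mult)
  also have "\<dots> \<le> s * ((N * (1 - M\<^sup>2)) * (\<gamma> * (\<Phi> s * sqrt (\<Phi> s) ^ (N - 3))))"
    using B assms by (intro mult_left_mono) auto
  also have "\<dots> = \<Phi> s * ((1 - M\<^sup>2) * (N * \<gamma>) * (s * sqrt (\<Phi> s) ^ (N - 3)))" by (simp only: mult_ac)
  finally have "\<Phi> s * F \<le> \<Phi> s * ((1 - M\<^sup>2) * (N * \<gamma>) * (s * sqrt (\<Phi> s) ^ (N - 3)))" .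
  then show ?thesis using pos unfolding F_def by simp
qed

lemma V_nonneg: "0 \<le> 1 - M\<^sup>2"
  using M_le_1 unfolding M_def by (simp add: power_le_one)

lemma \<gamma>_nonneg: "0 \<le> \<gamma>"
  unfolding \<gamma>_def by simp

lemma f_has_vector_derivative:
  "((\<lambda>x. f (of_real x)) has_vector_derivative (\<Sum>j<N. (w j - wm) * P' j (of_real x))) (at x within S)"
  by (rule has_vector_derivative_real_field[OF DERIV_f])

lemma continuous_on_f: "continuous_on S (\<lambda>x. f (of_real x))"
  by (intro continuous_at_imp_continuous_on ballI has_vector_derivative_continuous[OF f_has_vector_derivative])

lemma f_0: "f 0 = 1"
  by (simp add: f_def P_def I_def)

text \<open>Integrates \<open>f'_bound_main\<close> after replacing \<open>\<Phi>\<close> by a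
  linear majorant, in the applications its chord on \<open>[0, h]\<close>. These are
  \<open>s = \<kappa> / a\<close>, \<open>h = a\<close> and \<open>s = h = m\<close>.\<close>

lemma f_deviation_main:
  fixes s h :: real
  defines "p \<equiv> sqrt (1 - s * h) ^ (N - 1)"
  assumes N3: "3 \<le> N" and s: "0 < s" and h: "0 < h" "h \<le> m" "h < 1" "s * h < 1"
    and chord: "\<And>x. \<lbrakk>0 \<le> x; x \<le> h\<rbrakk> \<Longrightarrow> \<Phi> x \<le> 1 - s * x"
  shows "cmod (f (of_real h) - 1) \<le>
    (1 - M\<^sup>2) * (N * \<gamma> / s\<^sup>2 * (2 * (1 - p) / (real N - 1) - 2 * (1 - (1 - s * h) * p) / (real N + 1)))"
proof -
  define \<rho> where "\<rho> x = sqrt (1 - s * x)" for x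
  define A where "A = (1 - M\<^sup>2) * (N * \<gamma> / s\<^sup>2)"
  \<comment> \<open>A primitive of the majorant
    \<open>(1 - M\<^sup>2) * (N * \<gamma>) * (x * \<rho> x ^ (N - 3))\<close>.\<close>
  define \<phi> where "\<phi> x = A * (\<rho> x ^ (N + 1) * (2 / (real N + 1)) - \<rho> x ^ (N - 1) * (2 / (real N - 1)))" for x
  have sx: "0 < 1 - s * x" if "x < h" for x
  proof -
    have "s * x < s * h" using s that by simp
    then show ?thesis using h by simp
  qed
  have "cmod (f (of_real h) - f (of_real 0)) \<le> \<phi> h - \<phi> 0"
  proof (rule differentiable_bound_general[OF h(1), where f' = "\<lambda>x. \<Sum>j<N. (w j - wm) * P' j (of_real x)"
        and \<phi>' = "\<lambda>x. A * s\<^sup>2 * (x * \<rho> x ^ (N - 3))"])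
    show "continuous_on {0..h} (\<lambda>x. f (of_real x))" by (rule continuous_on_f)
    show "continuous_on {0..h} \<phi>" unfolding \<phi>_def \<rho>_def by (intro continuous_intros)
    fix x assume x: "0 < x" "x < h"
    show "((\<lambda>x. f (of_real x)) has_vector_derivative (\<Sum>j<N. (w j - wm) * P' j (of_real x))) (at x)"
      by (rule f_has_vector_derivative)
    have \<rho>0: "0 < \<rho> x" unfolding \<rho>_def using sx x by simp
    have \<rho>sq: "\<rho> x * \<rho> x = 1 - s * x" unfolding \<rho>_def using sx[OF x(2)] by simp
    define D where "D = - s / (2 * \<rho> x)"
    have d\<rho>: "(\<rho> has_real_derivative D) (at x)"
      unfolding \<rho>_def D_def using sx[OF x(2)]
      by (auto intro!: derivative_eq_intros simp: field_simps)
    have "(\<phi> has_real_derivative A * ((real (N + 1) * (D * \<rho> x ^ (N + 1 - Suc 0))) * (2 / (real N + 1))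
        - (real (N - 1) * (D * \<rho> x ^ (N - 1 - Suc 0))) * (2 / (real N - 1)))) (at x)"
      unfolding \<phi>_def by (intro DERIV_cmult DERIV_diff DERIV_cmult_right DERIV_power d\<rho>)
    also have "A * ((real (N + 1) * (D * \<rho> x ^ (N + 1 - Suc 0))) * (2 / (real N + 1))
        - (real (N - 1) * (D * \<rho> x ^ (N - 1 - Suc 0))) * (2 / (real N - 1)))
      = A * (2 * D * \<rho> x ^ N - 2 * D * \<rho> x ^ (N - 2))"
    proof -
      have "real (N + 1) * (D * y) * (2 / (real N + 1)) = 2 * D * y" for y by (simp add: field_simps)
      moreover have "real (N - 1) * (D * y) * (2 / (real N - 1)) = 2 * D * y" for y using N3 by (simp add: field_simps of_nat_diff)
      ultimately show ?thesis by (simp only:) (simp add: numeral_2_eq_2)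
    qed
    also have "\<dots> = A * s\<^sup>2 * (x * \<rho> x ^ (N - 3))"
    proof -
      have "N = 3 + (N - 3)" "N - 2 = 1 + (N - 3)" using N3 by auto
      then have "\<rho> x ^ N = (\<rho> x * \<rho> x) * \<rho> x * \<rho> x ^ (N - 3)" "\<rho> x ^ (N - 2) = \<rho> x * \<rho> x ^ (N - 3)"
        by (metis power_add power3_eq_cube, metis power_add power_one_right)
      then have "2 * D * \<rho> x ^ N - 2 * D * \<rho> x ^ (N - 2) = (2 * D * \<rho> x) * (\<rho> x * \<rho> x - 1) * \<rho> x ^ (N - 3)"
        by (simp only:) (simp add: algebra_simps)
      also have "2 * D * \<rho> x = - s" unfolding D_def using \<rho>0 by simp
      also have "\<rho> x * \<rho> x - 1 = - (s * x)" using \<rho>sq by simp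
      finally show ?thesis by (simp add: power2_eq_square)
    qed
    finally show "(\<phi> has_vector_derivative A * s\<^sup>2 * (x * \<rho> x ^ (N - 3))) (at x)"
      by (simp only: has_real_derivative_iff_has_vector_derivative)
    have "cmod (\<Sum>j<N. (w j - wm) * P' j (of_real x)) \<le> (1 - M\<^sup>2) * (N * \<gamma>) * (x * sqrt (\<Phi> x) ^ (N - 3))"
      by (rule f'_bound_main) (use N3 x h in auto)
    also have "\<dots> \<le> (1 - M\<^sup>2) * (N * \<gamma>) * (x * \<rho> x ^ (N - 3))"
      using V_nonneg \<gamma>_nonneg x chord[of x] \<Phi>_nonneg[of x] unfolding \<rho>_def
      by (intro mult_left_mono power_mono real_sqrt_le_mono mult_nonneg_nonneg) auto
    also have "\<dots> = A * s\<^sup>2 * (x * \<rho> x ^ (N - 3))" unfolding A_def using s by simp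
    finally show "cmod (\<Sum>j<N. (w j - wm) * P' j (of_real x)) \<le> A * s\<^sup>2 * (x * \<rho> x ^ (N - 3))" .
  qed
  also have "\<phi> h - \<phi> 0 = A * (2 * (1 - p) / (real N - 1) - 2 * (1 - (1 - s * h) * p) / (real N + 1))"
  proof -
    have "N + 1 = 2 + (N - 1)" using N3 by simp
    then have "\<rho> h ^ (N + 1) = (\<rho> h)\<^sup>2 * p" unfolding p_def \<rho>_def by (simp only: power_add)
    then have "\<rho> h ^ (N + 1) = (1 - s * h) * p" unfolding \<rho>_def using h by simp
    moreover have "\<rho> h ^ (N - 1) = p" unfolding p_def \<rho>_def ..
    moreover have "\<rho> 0 = 1" unfolding \<rho>_def by simp
    ultimately show ?thesis unfolding \<phi>_def by (simp only: power_one) (simp add: algebra_simps diff_divide_distrib add_divide_distrib)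
  qed
  finally show ?thesis unfolding A_def by (simp add: f_0 mult.assoc)
qed

text \<open>\<open>\<Phi>\<close> increases to the right of \<open>m\<close>, so the bound for the
  derivative at \<open>a\<close> serves on all of \<open>[m, a]\<close>.\<close>

lemma f_deviation_tail:
  assumes N2: "2 \<le> N" and m: "0 < m" "m < a"
  shows "cmod (f (of_real a) - f (of_real m)) \<le> (a - m) * (N * sqrt (1 - M\<^sup>2) * \<gamma> * sqrt (\<Phi> a) ^ (N - 1))"
proof -
  define C where "C = N * sqrt (1 - M\<^sup>2) * \<gamma> * sqrt (\<Phi> a) ^ (N - 1)"
  have "cmod (f (of_real a) - f (of_real m)) \<le> a * C - m * C"
  proof (rule differentiable_bound_general[OF m(2), where f' = "\<lambda>x. \<Sum>j<N. (w j - wm) * P' j (of_real x)"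
        and \<phi> = "\<lambda>x. x * C" and \<phi>' = "\<lambda>x. C"])
    show "continuous_on {m..a} (\<lambda>x. f (of_real x))" by (rule continuous_on_f)
    show "continuous_on {m..a} (\<lambda>x. x * C)" by (intro continuous_intros)
    fix x assume x: "m < x" "x < a"
    show "((\<lambda>x. f (of_real x)) has_vector_derivative (\<Sum>j<N. (w j - wm) * P' j (of_real x))) (at x)"
      by (rule f_has_vector_derivative)
    show "((\<lambda>x. x * C) has_vector_derivative C) (at x)"
      unfolding has_real_derivative_iff_has_vector_derivative[symmetric] by (auto intro!: derivative_eq_intros)
    have "(x - m)\<^sup>2 \<le> (a - m)\<^sup>2" using x by (intro power_mono) auto
    then have le: "\<Phi> x \<le> \<Phi> a" unfolding \<Phi>_alt by simp
    have "cmod (\<Sum>j<N. (w j - wm) * P' j (of_real x)) \<le> N * sqrt (1 - M\<^sup>2) * \<gamma> * sqrt (\<Phi> x) ^ (N - 1)"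
      by (rule f'_bound_tail[OF N2])
    also have "\<dots> \<le> C" unfolding C_def using le V_nonneg \<gamma>_nonneg \<Phi>_nonneg[of x]
      by (intro mult_left_mono power_mono real_sqrt_le_mono mult_nonneg_nonneg) auto
    finally show "cmod (\<Sum>j<N. (w j - wm) * P' j (of_real x)) \<le> C" .
  qed
  then show ?thesis unfolding C_def by (simp only: left_diff_distrib)
qed

text \<open>The triangle inequality in the definition of \<open>f\<close>, with
  \<open>cmod (1 + wm * h) \<le> sqrt (\<Phi> h)\<close>. The \<open>error_terms_less\<close> lemmas
  contradict the conclusion.\<close>

lemma one_minus_le:
  assumes I: "(N + 1) * cmod (I (of_real h)) \<le> a" and e: "cmod (f (of_real h) - 1) \<le> e"
  shows "1 - a * M \<le> \<Phi> h * sqrt (\<Phi> h) ^ (N - 1) + e"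
proof -
  have "1 \<le> cmod (f (of_real h)) + cmod (f (of_real h) - 1)"
    using norm_triangle_ineq4[of "f (of_real h)" "f (of_real h) - 1"] by simp
  moreover have "cmod (f (of_real h)) \<le> \<Phi> h * sqrt (\<Phi> h) ^ (N - 1) + a * M"
  proof -
    have "cmod (f (of_real h)) \<le> cmod (1 + wm * of_real h) * cmod (P (of_real h)) + M * ((N + 1) * cmod (I (of_real h)))"
      unfolding f_def M_def by (rule order_trans[OF norm_triangle_ineq4]) (simp add: norm_mult del: of_nat_Suc of_nat_add)
    also have "\<dots> \<le> sqrt (\<Phi> h) * sqrt (\<Phi> h) ^ N + M * a"
    proof (intro add_mono mult_mono norm_P I mult_left_mono)
      have "0 \<le> h\<^sup>2 * (1 - M\<^sup>2)" using V_nonneg by simp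
      then have "(cmod (1 + wm * of_real h))\<^sup>2 \<le> \<Phi> h" unfolding norm_wm_factor by simp
      then show "cmod (1 + wm * of_real h) \<le> sqrt (\<Phi> h)" by (rule real_le_rsqrt)
    qed (auto simp: M_def \<Phi>_nonneg)
    also have "sqrt (\<Phi> h) * sqrt (\<Phi> h) ^ N = \<Phi> h * sqrt (\<Phi> h) ^ (N - 1)"
      using N \<Phi>_nonneg[of h] by (cases N) (auto simp: mult.assoc[symmetric])
    finally show ?thesis by (simp add: mult.commute)
  qed
  ultimately show ?thesis using e by linarith
qed

lemma inconsistent: False
proof -
  define \<delta> where "\<delta> = 1 - a\<^sup>2"
  define b where "b = 1 - a * m / 2"
  have mM: "m \<le> M" "M \<le> 1" "m \<le> 1" using m_le_M M_le_1 by auto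
  have aa: "a * a < 1" using a mult_strict_mono[of a 1 a 1] by simp
  have am: "a * m \<le> a" using a mM by (simp add: mult_left_le)
  have \<delta>: "0 < \<delta>" "\<delta> \<le> 1" unfolding \<delta>_def using aa by (auto simp: power2_eq_square)
  have b: "0 < b" unfolding b_def using am a by simp
  note outer = outer_bound[OF b_def \<delta>_def]
  \<comment> \<open>For \<open>\<kappa> \<le> 0\<close> the right side of \<open>outer_bound\<close>
    is at most 1 and the left side exceeds 1.\<close>
  have \<kappa>0: "0 < \<kappa>"
  proof (rule ccontr)
    assume "\<not> 0 < \<kappa>"
    then have "\<delta> * \<kappa> \<le> 0" using \<delta> by (simp add: mult_nonneg_nonpos)
    then have "sqrt (1 + \<delta> * \<kappa>) ^ N \<le> 1" using outer(2) by (intro power_le_one) auto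
    moreover have "0 < N * \<delta> * b" using N \<delta> b by simp
    ultimately show False using outer(1) by linarith
  qed
  have a0: "0 < a" using \<kappa>0 a unfolding \<kappa>_def by (cases "a = 0") auto
  have m0: "0 < m" using \<kappa>0 a0 unfolding \<kappa>_def by (simp add: zero_less_mult_iff)
  have \<kappa>1: "\<kappa> < 1"
  proof -
    have "\<kappa> = 2 * (a * m) - a * a" unfolding \<kappa>_def by (simp add: algebra_simps)
    moreover have "0 < (1 - a) * (1 - a)" using a by simp
    then have "0 < 1 - 2 * a + a * a" by (simp add: algebra_simps)
    ultimately show ?thesis using am by linarith
  qed
  have N5: "5 \<le> N"
  proof (rule degree_ge_five[OF \<delta> \<kappa>1 N _ \<kappa>0])
    have "(3 + \<delta> - \<kappa>) / 4 = b" unfolding \<delta>_def \<kappa>_def b_def by (simp add: power2_eq_square field_simps)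
    moreover have "(1 + N * \<delta> * b)\<^sup>2 \<le> (sqrt (1 + \<delta> * \<kappa>) ^ N)\<^sup>2"
      using outer \<delta> b by (intro power_mono) auto
    moreover have "(sqrt (1 + \<delta> * \<kappa>) ^ N)\<^sup>2 = (1 + \<delta> * \<kappa>) ^ N"
      using outer(2) by (metis mult.commute power_mult real_sqrt_pow2)
    ultimately show "(1 + N * \<delta> * ((3 + \<delta> - \<kappa>) / 4))\<^sup>2 \<le> (1 + \<delta> * \<kappa>) ^ N" by simp
  qed
  have c1: "1 + N * \<delta> * b \<le> exp (N * \<delta> * \<kappa> / 2)"
  proof -
    have "sqrt (1 + \<delta> * \<kappa>) \<le> exp (\<delta> * \<kappa> / 2)"
    proof (rule real_le_lsqrt)
      show "1 + \<delta> * \<kappa> \<le> (exp (\<delta> * \<kappa> / 2))\<^sup>2"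
        using exp_ge_add_one_self[of "\<delta> * \<kappa>"] by (simp flip: exp_of_nat_mult)
    qed (use outer in auto)
    then have "sqrt (1 + \<delta> * \<kappa>) ^ N \<le> exp (\<delta> * \<kappa> / 2) ^ N" using outer by (intro power_mono) auto
    also have "\<dots> = exp (N * \<delta> * \<kappa> / 2)" by (simp flip: exp_of_nat_mult)
    finally show ?thesis using outer(1) by linarith
  qed
  have \<gamma>: "3/2 \<le> \<gamma>" "\<gamma> \<le> 165/100" using sqrt_power_bounds[OF N5] unfolding \<gamma>_def by auto
  have I_a: "(N + 1) * cmod (I (of_real a)) \<le> a" using inner_bound[of 0] a0 by simp
  have \<Phi>a: "\<Phi> a = 1 - \<kappa>" unfolding \<Phi>_def \<kappa>_def by (simp add: power2_eq_square algebra_simps)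
  show False
  proof (cases "a \<le> m")
    case True
    have "cmod (f (of_real a) - 1) \<le> (1 - M\<^sup>2) * (N * \<gamma> / (\<kappa> / a)\<^sup>2 *
       (2 * (1 - sqrt (1 - \<kappa> / a * a) ^ (N - 1)) / (real N - 1)
        - 2 * (1 - (1 - \<kappa> / a * a) * sqrt (1 - \<kappa> / a * a) ^ (N - 1)) / (real N + 1)))"
    proof (rule f_deviation_main)
      fix x assume x: "0 \<le> x" "x \<le> a"
      then have "x * x \<le> a * x" by (intro mult_right_mono) auto
      moreover have "\<kappa> / a * x = (2 * m - a) * x" unfolding \<kappa>_def using a0 by simp
      ultimately show "\<Phi> x \<le> 1 - \<kappa> / a * x" unfolding \<Phi>_def by (simp only:) (simp add: power2_eq_square algebra_simps)
    qed (use N5 True a a0 \<kappa>0 \<kappa>1 in auto)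
    moreover have "\<kappa> / a * a = \<kappa>" using a0 by simp
    ultimately have "cmod (f (of_real a) - 1) \<le> (1 - M\<^sup>2) * (N * \<gamma> / (\<kappa> / a)\<^sup>2 *
       (2 * (1 - sqrt (1 - \<kappa>) ^ (N - 1)) / (real N - 1)
        - 2 * (1 - (1 - \<kappa>) * sqrt (1 - \<kappa>) ^ (N - 1)) / (real N + 1)))" by (simp only:)
    from one_minus_le[OF I_a this]
    show False
      using error_terms_less_mean_ge[OF a0 a(2) True mM(1,2) N5 c1[unfolded b_def \<delta>_def \<kappa>_def] \<gamma>]
      unfolding \<Phi>a \<kappa>_def by linarith
  next
    case False
    then have ma: "m < a" by simp
    have bg: "b = (1 + (1 - a * m)) / 2" unfolding b_def by simp
    have low: "74/10 * (1 - a * m) \<le> N * (1 - a\<^sup>2) * (a * (2 * m - a))"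
      using degree_lower_mean_less[OF a0 a(2) ma \<kappa>0[unfolded \<kappa>_def] _ c1[unfolded bg \<delta>_def \<kappa>_def]] N by simp
    have N8: "8 \<le> N"
    proof -
      have "a * m < a * a" using ma a0 by simp
      then have "74/10 * \<delta> < 74/10 * (1 - a * m)" unfolding \<delta>_def by (simp add: power2_eq_square)
      also have "\<dots> \<le> N * \<delta> * \<kappa>" using low unfolding \<delta>_def \<kappa>_def .
      also have "\<dots> \<le> N * \<delta> * 1" using \<kappa>1 \<delta> by (intro mult_left_mono) auto
      finally have "74/10 * \<delta> < N * \<delta>" by simp
      then have "74/10 < real N" using \<delta> by (simp only: mult_less_cancel_right_pos)
      then show ?thesis by linarith
    qed
    have m1: "m * m < 1" using ma a m0 mult_strict_mono[of m 1 m 1] by simp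
    have dev_m: "cmod (f (of_real m) - 1) \<le> (1 - M\<^sup>2) * (N * \<gamma> / m\<^sup>2 *
       (2 * (1 - sqrt (1 - m\<^sup>2) ^ (N - 1)) / (real N - 1)
        - 2 * (1 - (1 - m\<^sup>2) * sqrt (1 - m\<^sup>2) ^ (N - 1)) / (real N + 1)))"
      unfolding power2_eq_square[of m]
    proof (rule f_deviation_main[of m m, unfolded power2_eq_square[of m]])
      fix x assume x: "0 \<le> x" "x \<le> m"
      then have "x * x \<le> m * x" by (intro mult_right_mono) auto
      then show "\<Phi> x \<le> 1 - m * x" unfolding \<Phi>_def by (simp add: power2_eq_square mult.commute)
    qed (use N5 ma a m0 m1 in auto)
    show False
    \<comment> \<open>These are two situations in which \<open>inner_bound\<close> with
      \<open>c = a - m\<close> gives the bound \<open>a\<close> needed at \<sigma> =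
      \<open>m\<close>. In the remaining one \<open>m\<close> is so close to \<open>a\<close> that
      \<sigma> = \<open>a\<close> works despite the tail.\<close>
    proof (cases "a \<le> 3/5 \<or> 2 \<le> N * (a - m) * (1 + \<kappa>)")
      case True
      define c where "c = a - m"
      have c: "0 \<le> c" "c < a" "0 < c" unfolding c_def using ma m0 by auto
      have ac: "a * c < 1" using c a mult_strict_mono[of a 1 c 1] by simp
      define Q where "Q = c\<^sup>2 + 2 * m * c * (1 - a * c) + (1 - a * c)\<^sup>2"
      have Q: "Q = 1 - c\<^sup>2 * (1 + \<kappa>)" unfolding Q_def \<kappa>_def c_def by (simp add: power2_eq_square algebra_simps)
      have Q0: "0 \<le> Q" unfolding Q_def using c ac m0 by (intro add_nonneg_nonneg mult_nonneg_nonneg) auto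
      have Q1: "Q \<le> 1" unfolding Q using \<kappa>0 by simp
      have "(N + 1) * cmod (I (of_real m)) \<le> (a - c) * ((1 + c) / (1 - a * c)) * sqrt Q ^ N"
        using inner_bound[OF c(1,2)] unfolding Q_def by (simp add: c_def)
      also have "\<dots> \<le> a"
      proof (cases "a \<le> 3/5")
        case True
        have "sqrt Q ^ N \<le> 1" using Q0 Q1 by (intro power_le_one) auto
        then have "(a - c) * ((1 + c) / (1 - a * c)) * sqrt Q ^ N \<le> (a - c) * ((1 + c) / (1 - a * c)) * 1"
          using c ac by (intro mult_left_mono) auto
        also have "\<dots> \<le> a"
        proof -
          have "a * a \<le> 3/5 * (3/5)" using True a by (intro mult_mono) auto
          then have "a * a + a - 1 - c \<le> 0" using True c by simp
          then have "c * (a * a + a - 1 - c) \<le> 0" using c by (simp add: mult_nonneg_nonpos)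
          then have "(a - c) * (1 + c) \<le> a * (1 - a * c)" by (simp add: algebra_simps)
          then show ?thesis using ac by (simp add: pos_divide_le_eq)
        qed
        finally show ?thesis .
      next
        case False
        with \<open>a \<le> 3/5 \<or> _\<close> have big: "2 \<le> N * c * (1 + \<kappa>)" unfolding c_def by simp
        \<comment> \<open>Together with \<open>big\<close> this gives
          \<open>sqrt Q ^ N \<le> exp (- c)\<close>, which cancels the factor
          \<open>1 + c\<close>.\<close>
        have "sqrt Q \<le> exp (- (c\<^sup>2 * (1 + \<kappa>) / 2))"
        proof (rule real_le_lsqrt)
          show "Q \<le> (exp (- (c\<^sup>2 * (1 + \<kappa>) / 2)))\<^sup>2"
            unfolding Q using exp_ge_add_one_self[of "- (c\<^sup>2 * (1 + \<kappa>))"] by (simp flip: exp_of_nat_mult)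
        qed auto
        then have "sqrt Q ^ N \<le> exp (- (c\<^sup>2 * (1 + \<kappa>) / 2)) ^ N" using Q0 by (intro power_mono) auto
        also have "\<dots> = exp (- (c * (N * c * (1 + \<kappa>)) / 2))"
          by (simp add: power2_eq_square mult_ac flip: exp_of_nat_mult)
        also have "\<dots> \<le> exp (- c)" using mult_left_mono[OF big c(1)] by simp
        finally have "(1 + c) * sqrt Q ^ N \<le> exp c * exp (- c)"
          using c exp_ge_add_one_self[of c] Q0 by (intro mult_mono) auto
        then have e1: "(1 + c) * sqrt Q ^ N \<le> 1" by (simp flip: exp_add)
        have e2: "(a - c) / (1 - a * c) \<le> a"
        proof -
          have "a * a * c \<le> 1 * c" using aa c by (intro mult_right_mono) auto
          then show ?thesis using ac by (simp add: pos_divide_le_eq algebra_simps)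
        qed
        have "(a - c) * ((1 + c) / (1 - a * c)) * sqrt Q ^ N = (a - c) / (1 - a * c) * ((1 + c) * sqrt Q ^ N)" by simp
        also have "\<dots> \<le> a * 1" using e1 e2 a0 c Q0 by (intro mult_mono) auto
        finally show ?thesis by simp
      qed
      finally have I_m: "(N + 1) * cmod (I (of_real m)) \<le> a" .
      have \<Phi>m: "\<Phi> m = 1 - m\<^sup>2" unfolding \<Phi>_alt by simp
      from one_minus_le[OF I_m dev_m] error_terms_less_at_mean[OF a0 a(2) m0 ma mM(1,2) N8 low \<gamma>_nonneg \<gamma>(2)]
      show False unfolding \<Phi>m by linarith
    next
      case False
      have "cmod (f (of_real a) - 1) \<le> cmod (f (of_real m) - 1) + cmod (f (of_real a) - f (of_real m))"
        using norm_triangle_ineq[of "f (of_real m) - 1" "f (of_real a) - f (of_real m)"] by simp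
      also note add_mono[OF dev_m f_deviation_tail[OF _ m0 ma]]
      finally have dev: "cmod (f (of_real a) - 1) \<le> (1 - M\<^sup>2) * (N * \<gamma> / m\<^sup>2 *
       (2 * (1 - sqrt (1 - m\<^sup>2) ^ (N - 1)) / (real N - 1)
        - 2 * (1 - (1 - m\<^sup>2) * sqrt (1 - m\<^sup>2) ^ (N - 1)) / (real N + 1)))
        + (a - m) * (N * sqrt (1 - M\<^sup>2) * \<gamma> * sqrt (\<Phi> a) ^ (N - 1))" using N5 by simp
      have a35: "3/5 < a" and small: "N * (a - m) * (1 + a * (2 * m - a)) < 2"
        using False unfolding \<kappa>_def by auto
      from one_minus_le[OF I_a dev]
        error_terms_less_at_zero[OF a35 a(2) m0 ma mM(1,2) N8 \<kappa>0[unfolded \<kappa>_def] small low \<gamma>_nonneg \<gamma>(2)]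
      show False unfolding \<Phi>a \<kappa>_def by linarith
    qed
  qed
qed

end

section \<open>Polynomials\<close>

text \<open>For \<open>r < 1\<close> the locale gives strict inequality, so equality forces
  \<open>r = 1\<close>. There \<open>disc\<close> becomes \<open>Re (u k) \<le> -1/2\<close>, and
  expanding the squares of \<open>cmod (w j + 1)\<close> gives both claims.\<close>

lemma sum_squares_ge_card:
  fixes r :: real and w u :: "nat \<Rightarrow> complex"
  assumes N: "0 < N" and r: "0 \<le> r" "r \<le> 1"
    and rel: "critical_rel N w u"
    and disc: "\<And>k. k < N \<Longrightarrow> cmod (1 + r * u k) \<le> cmod (u k)"
  shows "N \<le> (\<Sum>j<N. (cmod (w j))\<^sup>2)"
    and "(\<Sum>j<N. (cmod (w j))\<^sup>2) = N \<Longrightarrow> r = 1 \<and> (\<forall>j<N. w j = -1)"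
proof -
  have "N \<le> (\<Sum>j<N. (cmod (w j))\<^sup>2) \<and> ((\<Sum>j<N. (cmod (w j))\<^sup>2) = N \<longrightarrow> r = 1 \<and> (\<forall>j<N. w j = -1))"
  proof (cases "r = 1")
    case False
    have "N < (\<Sum>j<N. (cmod (w j))\<^sup>2)"
    proof (rule ccontr)
      assume "\<not> N < (\<Sum>j<N. (cmod (w j))\<^sup>2)"
      then have sum_sq: "(\<Sum>j<N. (cmod (w j))\<^sup>2) \<le> N" by simp
      have "r < 1" using r False by simp
      then have "critical_config N w u r"
        by (intro critical_config.intro N r rel disc sum_sq)
      then show False by (rule critical_config.inconsistent)
    qed
    then show ?thesis by simp
  next
    case True
    have Re_u: "Re (u k) \<le> - (1/2)" if "k < N" for k
    proof -
      have "(cmod (1 + r * u k))\<^sup>2 \<le> (cmod (u k))\<^sup>2" using disc[OF that] by (intro power_mono) auto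
      then show ?thesis unfolding True cmod_power2 by (simp add: power2_eq_square algebra_simps)
    qed
    have "(\<Sum>j<N. Re (w j)) = 2 * (\<Sum>k<N. Re (u k))"
      using arg_cong[OF critical_rel_sum[OF rel], of Re] by simp
    also have "\<dots> \<le> 2 * (\<Sum>k<N. - (1/2))" using Re_u by (intro mult_left_mono sum_mono) auto
    finally have Re_w: "(\<Sum>j<N. Re (w j)) \<le> - real N" by simp
    have "(\<Sum>j<N. (cmod (w j + 1))\<^sup>2) = (\<Sum>j<N. (cmod (w j))\<^sup>2 + 2 * Re (w j) + 1)"
      unfolding cmod_power2 by (intro sum.cong refl) (simp add: power2_eq_square algebra_simps)
    also have "\<dots> = (\<Sum>j<N. (cmod (w j))\<^sup>2) + 2 * (\<Sum>j<N. Re (w j)) + N"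
      by (simp add: sum.distrib sum_distrib_left)
    also have "\<dots> \<le> (\<Sum>j<N. (cmod (w j))\<^sup>2) - N" using Re_w by simp
    finally have le: "(\<Sum>j<N. (cmod (w j + 1))\<^sup>2) \<le> (\<Sum>j<N. (cmod (w j))\<^sup>2) - N" .
    have nonneg: "0 \<le> (\<Sum>j<N. (cmod (w j + 1))\<^sup>2)" by (intro sum_nonneg) auto
    have w1: "w j = -1" if "(\<Sum>j<N. (cmod (w j))\<^sup>2) = N" "j < N" for j
    proof -
      have "(\<Sum>j<N. (cmod (w j + 1))\<^sup>2) = 0" using le nonneg that(1) by simp
      then have "(cmod (w j + 1))\<^sup>2 = 0" using that(2) by (subst (asm) sum_nonneg_eq_0_iff) auto
      then show ?thesis by (simp add: add_eq_0_iff2)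
    qed
    have "N \<le> (\<Sum>j<N. (cmod (w j))\<^sup>2)" using le nonneg by linarith
    then show ?thesis using True w1 by blast
  qed
  then show "N \<le> (\<Sum>j<N. (cmod (w j))\<^sup>2)"
    "(\<Sum>j<N. (cmod (w j))\<^sup>2) = N \<Longrightarrow> r = 1 \<and> (\<forall>j<N. w j = -1)" by blast+
qed

section \<open>Translation between polynomials and \<open>critical_rel\<close>\<close>

lemma critical_relI:
  fixes \<zeta> z :: "nat \<Rightarrow> complex" and a :: complex
  assumes N: "0 < N"
    and id: "\<And>t. of_nat (N + 1) * (\<Prod>j<N. t - \<zeta> j) =
      (\<Prod>k<N. t - z k) + (t - a) * (\<Sum>k<N. \<Prod>i\<in>{..<N}-{k}. t - z i)"
    and \<zeta>: "\<And>j. j < N \<Longrightarrow> \<zeta> j \<noteq> a"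
  shows "critical_rel N (\<lambda>j. 1 / (\<zeta> j - a)) (\<lambda>k. 1 / (z k - a))" and "\<And>k. k < N \<Longrightarrow> z k \<noteq> a"
proof -
  define w u where "w j = 1 / (\<zeta> j - a)" and "u k = 1 / (z k - a)" for j k
  define A Z where "A = (\<Prod>j<N. a - \<zeta> j)" and "Z = (\<Prod>k<N. a - z k)"
  \<comment> \<open>At \<open>t = a\<close> the second summand of \<open>id\<close> vanishes; as no
    critical point equals \<open>a\<close>, the zero \<open>a\<close> is simple.\<close>
  have AZ: "of_nat (N + 1) * A = Z" using id[of a] unfolding A_def Z_def by simp
  have "A \<noteq> 0" unfolding A_def using \<zeta> by auto
  then have Z0: "Z \<noteq> 0" unfolding AZ[symmetric] by (simp del: of_nat_Suc of_nat_add)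
  then show z: "z k \<noteq> a" if "k < N" for k using that unfolding Z_def by auto
  have rest: "(\<Prod>i\<in>{..<N}-{k}. a - z i) = - (Z * u k)" if "k < N" for k
    using that z[OF that] prod.remove[of "{..<N}" k "\<lambda>i. a - z i"] unfolding Z_def u_def by (simp add: field_simps)
  have "(\<Prod>j<N. \<tau> + \<sigma> * w j) = (\<Prod>k<N. \<tau> + \<sigma> * u k) + \<sigma> * (\<Sum>k<N. u k * (\<Prod>i\<in>{..<N}-{k}. \<tau> + \<sigma> * u i))" for \<tau> \<sigma>
  proof (cases "\<tau> = 0")
    case False
    define t where "t = a - \<sigma> / \<tau>"
    have f1: "t - \<zeta> j = (a - \<zeta> j) * (\<tau> + \<sigma> * w j) / \<tau>" if "j < N" for j
      using \<zeta>[OF that] False unfolding t_def w_def by (simp add: field_simps)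
    have f2: "t - z k = (a - z k) * (\<tau> + \<sigma> * u k) / \<tau>" if "k < N" for k
      using z[OF that] False unfolding t_def u_def by (simp add: field_simps)
    have "(\<Prod>j<N. t - \<zeta> j) = (\<Prod>j<N. (a - \<zeta> j) * (\<tau> + \<sigma> * w j) / \<tau>)" by (intro prod.cong refl) (use f1 in auto)
    also have "\<dots> = A * (\<Prod>j<N. \<tau> + \<sigma> * w j) / \<tau> ^ N" by (simp add: prod_dividef prod.distrib A_def)
    finally have e1: "of_nat (N + 1) * (\<Prod>j<N. t - \<zeta> j) = Z * (\<Prod>j<N. \<tau> + \<sigma> * w j) / \<tau> ^ N"
      unfolding AZ[symmetric] by simp
    have "(\<Prod>k<N. t - z k) = (\<Prod>k<N. (a - z k) * (\<tau> + \<sigma> * u k) / \<tau>)" by (intro prod.cong refl) (use f2 in auto)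
    also have "\<dots> = Z * (\<Prod>k<N. \<tau> + \<sigma> * u k) / \<tau> ^ N" by (simp add: prod_dividef prod.distrib Z_def)
    finally have e2: "(\<Prod>k<N. t - z k) = Z * (\<Prod>k<N. \<tau> + \<sigma> * u k) / \<tau> ^ N" .
    have e3: "(t - a) * (\<Prod>i\<in>{..<N}-{k}. t - z i) = Z / \<tau> ^ N * (\<sigma> * (u k * (\<Prod>i\<in>{..<N}-{k}. \<tau> + \<sigma> * u i)))"
      if "k < N" for k
    proof -
      have "(\<Prod>i\<in>{..<N}-{k}. t - z i) = (\<Prod>i\<in>{..<N}-{k}. (a - z i) * (\<tau> + \<sigma> * u i) / \<tau>)"
        by (intro prod.cong refl) (use f2 in auto)
      also have "\<dots> = - (Z * u k) * (\<Prod>i\<in>{..<N}-{k}. \<tau> + \<sigma> * u i) / \<tau> ^ (N - 1)"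
        using that by (simp add: prod_dividef prod.distrib rest)
      finally have *: "(\<Prod>i\<in>{..<N}-{k}. t - z i) = - (Z * u k) * (\<Prod>i\<in>{..<N}-{k}. \<tau> + \<sigma> * u i) / \<tau> ^ (N - 1)" .
      have "\<tau> ^ N = \<tau> * \<tau> ^ (N - 1)" using N by (cases N) auto
      then show ?thesis unfolding * using False by (simp add: t_def)
    qed
    have "Z / \<tau> ^ N * (\<Prod>j<N. \<tau> + \<sigma> * w j) = of_nat (N + 1) * (\<Prod>j<N. t - \<zeta> j)" unfolding e1 by simp
    also have "\<dots> = (\<Prod>k<N. t - z k) + (\<Sum>k<N. (t - a) * (\<Prod>i\<in>{..<N}-{k}. t - z i))"
      unfolding id by (simp add: sum_distrib_left)
    also have "(\<Sum>k<N. (t - a) * (\<Prod>i\<in>{..<N}-{k}. t - z i))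
      = (\<Sum>k<N. Z / \<tau> ^ N * (\<sigma> * (u k * (\<Prod>i\<in>{..<N}-{k}. \<tau> + \<sigma> * u i))))"
      by (intro sum.cong refl) (use e3 in auto)
    also have "(\<Prod>k<N. t - z k) + \<dots> = Z / \<tau> ^ N * ((\<Prod>k<N. \<tau> + \<sigma> * u k) + \<sigma> * (\<Sum>k<N. u k * (\<Prod>i\<in>{..<N}-{k}. \<tau> + \<sigma> * u i)))"
      unfolding e2 distrib_left sum_distrib_left by simp
    finally show ?thesis using Z0 False by (subst (asm) mult_left_cancel) auto
  next
    case True
    have "(\<Prod>j<N. w j) * ((- 1) ^ N * A) = (\<Prod>j<N. w j * (- 1 * (a - \<zeta> j)))" by (simp only: A_def prod.distrib prod_constant card_lessThan)
    also have "\<dots> = (\<Prod>j<N. 1)" by (intro prod.cong refl) (use \<zeta> in \<open>auto simp: w_def field_simps\<close>)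
    finally have wA: "(\<Prod>j<N. w j) * ((- 1) ^ N * A) = 1" by simp
    have "(\<Prod>k<N. u k) * ((- 1) ^ N * Z) = (\<Prod>k<N. u k * (- 1 * (a - z k)))" by (simp only: Z_def prod.distrib prod_constant card_lessThan)
    also have "\<dots> = (\<Prod>k<N. 1)" by (intro prod.cong refl) (use z in \<open>auto simp: u_def field_simps\<close>)
    finally have uZ: "(\<Prod>k<N. u k) * ((- 1) ^ N * Z) = 1" by simp
    have "((\<Prod>j<N. w j) * ((- 1) ^ N * A)) * (of_nat (N + 1) * (\<Prod>k<N. u k)) =
        (\<Prod>j<N. w j) * ((\<Prod>k<N. u k) * ((- 1) ^ N * (of_nat (N + 1) * A)))" by (simp only: mult_ac)
    then have wu: "(\<Prod>j<N. w j) = of_nat (N + 1) * (\<Prod>k<N. u k)" unfolding AZ wA uZ by simp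
    have pk: "\<sigma> * (u k * (\<Prod>i\<in>{..<N}-{k}. \<sigma> * u i)) = (\<Prod>i<N. \<sigma> * u i)" if "k < N" for k
      using that prod.remove[of "{..<N}" k "\<lambda>i. \<sigma> * u i"] by simp
    have "\<sigma> * (\<Sum>k<N. u k * (\<Prod>i\<in>{..<N}-{k}. \<sigma> * u i)) = (\<Sum>k<N. \<Prod>i<N. \<sigma> * u i)"
      unfolding sum_distrib_left by (intro sum.cong refl) (use pk in auto)
    then show ?thesis unfolding True by (simp add: prod.distrib wu algebra_simps)
  qed
  then show "critical_rel N (\<lambda>j. 1 / (\<zeta> j - a)) (\<lambda>k. 1 / (z k - a))"
    unfolding critical_rel_def w_def u_def by blast
qed

lemma critical_rel_scale:
  assumes "critical_rel N w u"
  shows "critical_rel N (\<lambda>j. e * w j) (\<lambda>k. e * u k)"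
  unfolding critical_rel_def
proof (intro allI)
  fix \<tau> \<sigma>
  show "(\<Prod>j<N. \<tau> + \<sigma> * (e * w j)) = (\<Prod>k<N. \<tau> + \<sigma> * (e * u k)) +
      \<sigma> * (\<Sum>k<N. e * u k * (\<Prod>i\<in>{..<N}-{k}. \<tau> + \<sigma> * (e * u i)))"
    using assms[unfolded critical_rel_def, rule_format, of \<tau> "\<sigma> * e"]
    by (simp add: sum_distrib_left mult.assoc)
qed

text \<open>Bernoulli's inequality for real exponents, obtained from Young's inequality with weights
  \<open>1 / r\<close> and \<open>1 - 1 / r\<close>.\<close>

lemma powr_tangent:
  fixes t r :: real
  assumes "0 < t" "1 \<le> r"
  shows "1 + r * (t - 1) \<le> t powr r"
proof -
  have "(t powr r) powr (1 / r) * 1 powr (1 - 1 / r) \<le> (1 / r) * t powr r + (1 - 1 / r) * 1"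
    by (rule Youngs_inequality_0) (use assms in auto)
  then have "t \<le> t powr r / r + (1 - 1 / r)" using assms by (simp add: powr_powr)
  then have "r * t \<le> r * (t powr r / r + (1 - 1 / r))" using assms by (intro mult_left_mono) auto
  then show ?thesis using assms by (simp add: algebra_simps)
qed

lemma recip_distance_squares:
  fixes \<zeta> z :: "nat \<Rightarrow> complex" and a :: complex
  assumes N: "0 < N"
    and id: "\<And>t. of_nat (N + 1) * (\<Prod>j<N. t - \<zeta> j) =
      (\<Prod>k<N. t - z k) + (t - a) * (\<Sum>k<N. \<Prod>i\<in>{..<N}-{k}. t - z i)"
    and \<zeta>: "\<And>j. j < N \<Longrightarrow> \<zeta> j \<noteq> a" and z: "\<And>k. k < N \<Longrightarrow> cmod (z k) \<le> 1" and a: "cmod a \<le> 1"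
  shows "N \<le> (\<Sum>j<N. 1 / (cmod (a - \<zeta> j))\<^sup>2)"
    and "(\<Sum>j<N. 1 / (cmod (a - \<zeta> j))\<^sup>2) = N \<Longrightarrow> cmod a = 1 \<and> (\<forall>j<N. \<zeta> j = 0)"
proof -
  \<comment> \<open>Multiplying by the direction \<open>e\<close> of \<open>a\<close> rotates
    \<open>a\<close> to \<open>cmod a\<close> without changing moduli.\<close>
  define e where "e = (if a = 0 then 1 else sgn a)"
  have e: "cmod e = 1" "a = cmod a * e" by (simp add: e_def norm_sgn, simp add: e_def sgn_eq)
  note cr = critical_relI[OF N id \<zeta>]
  define w u where "w j = e * (1 / (\<zeta> j - a))" and "u k = e * (1 / (z k - a))" for j k
  have rel: "critical_rel N w u" unfolding w_def u_def by (rule critical_rel_scale[OF cr(1)])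
  have disc: "cmod (1 + cmod a * u k) \<le> cmod (u k)" if "k < N" for k
  proof -
    have "z k \<noteq> a" using cr(2) that by blast
    then have "1 + cmod a * u k = z k / (z k - a)"
      unfolding u_def mult.assoc[symmetric] e(2)[symmetric] by (simp add: field_simps)
    moreover have "cmod (z k) / cmod (z k - a) \<le> 1 / cmod (z k - a)" using z[OF that] by (intro divide_right_mono) auto
    ultimately show ?thesis unfolding u_def by (simp add: norm_mult norm_divide e(1))
  qed
  have eq: "(\<Sum>j<N. (cmod (w j))\<^sup>2) = (\<Sum>j<N. 1 / (cmod (a - \<zeta> j))\<^sup>2)"
    unfolding w_def by (intro sum.cong refl) (simp add: norm_mult norm_divide e(1) power_divide norm_minus_commute)
  note sq = sum_squares_ge_card[OF N _ a rel disc]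
  show "N \<le> (\<Sum>j<N. 1 / (cmod (a - \<zeta> j))\<^sup>2)" using sq(1) unfolding eq by simp
  assume "(\<Sum>j<N. 1 / (cmod (a - \<zeta> j))\<^sup>2) = N"
  then have *: "cmod a = 1" "\<forall>j<N. w j = -1" using sq(2) unfolding eq by auto
  have "\<zeta> j = 0" if "j < N" for j
  proof -
    have "e / (\<zeta> j - a) = -1" using *(2) that unfolding w_def by simp
    then have "e = a - \<zeta> j" using \<zeta>[OF that] by (simp add: field_simps)
    then show ?thesis using e(2) *(1) by simp
  qed
  then show "cmod a = 1 \<and> (\<forall>j<N. \<zeta> j = 0)" using * by blast
qed

text \<open>Termwise \<open>powr_tangent\<close> with exponent \<open>s / 2\<close> at the squared
  reciprocal distances; equality forces equality for exponent 2.\<close>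

lemma recip_distance_powers:
  fixes \<zeta> z :: "nat \<Rightarrow> complex" and a :: complex and s :: real
  assumes N: "0 < N"
    and id: "\<And>t. of_nat (N + 1) * (\<Prod>j<N. t - \<zeta> j) =
      (\<Prod>k<N. t - z k) + (t - a) * (\<Sum>k<N. \<Prod>i\<in>{..<N}-{k}. t - z i)"
    and \<zeta>: "\<And>j. j < N \<Longrightarrow> \<zeta> j \<noteq> a" and z: "\<And>k. k < N \<Longrightarrow> cmod (z k) \<le> 1" and a: "cmod a \<le> 1"
    and s: "2 \<le> s"
  shows "N \<le> (\<Sum>j<N. 1 / cmod (a - \<zeta> j) powr s)"
    and "(\<Sum>j<N. 1 / cmod (a - \<zeta> j) powr s) = N \<Longrightarrow> cmod a = 1 \<and> (\<forall>j<N. \<zeta> j = 0)"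
proof -
  define S where "S = (\<Sum>j<N. 1 / (cmod (a - \<zeta> j))\<^sup>2)"
  note sq = recip_distance_squares[OF N id \<zeta> z a, folded S_def]
  have "N + s / 2 * (S - N) = (\<Sum>j<N. 1 + s / 2 * (1 / (cmod (a - \<zeta> j))\<^sup>2 - 1))"
    unfolding S_def sum.distrib sum_distrib_left[symmetric] sum_subtractf by simp
  also have "\<dots> \<le> (\<Sum>j<N. 1 / cmod (a - \<zeta> j) powr s)"
  proof (rule sum_mono)
    fix j assume "j \<in> {..<N}"
    then have x: "0 < cmod (a - \<zeta> j)" using \<zeta>[of j] by simp
    define x where "x = cmod (a - \<zeta> j)"
    have "1 / x powr s = (1 / x\<^sup>2) powr (s / 2)"
    proof -
      have "(1 / x\<^sup>2) powr (s / 2) = 1 / (x powr 2) powr (s / 2)" using x unfolding x_def by (simp add: powr_divide)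
      then show ?thesis by (simp add: powr_powr)
    qed
    moreover have "1 + s / 2 * (1 / x\<^sup>2 - 1) \<le> (1 / x\<^sup>2) powr (s / 2)"
      by (rule powr_tangent) (use x s in \<open>auto simp: x_def\<close>)
    ultimately show "1 + s / 2 * (1 / (cmod (a - \<zeta> j))\<^sup>2 - 1) \<le> 1 / cmod (a - \<zeta> j) powr s"
      unfolding x_def by simp
  qed
  finally have le: "N + s / 2 * (S - N) \<le> (\<Sum>j<N. 1 / cmod (a - \<zeta> j) powr s)" .
  have "0 \<le> s / 2 * (S - N)" using s sq(1) by simp
  then show "N \<le> (\<Sum>j<N. 1 / cmod (a - \<zeta> j) powr s)" using le by linarith
  assume "(\<Sum>j<N. 1 / cmod (a - \<zeta> j) powr s) = N"
  then have "s / 2 * (S - N) \<le> 0" using le by linarith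
  then have "S = N" using s sq(1) by (simp add: mult_le_0_iff)
  then show "cmod a = 1 \<and> (\<forall>j<N. \<zeta> j = 0)" using sq(2) by blast
qed

lemma proots_prod_linear:
  fixes \<zeta> :: "nat \<Rightarrow> complex"
  assumes "c \<noteq> 0"
  shows "proots (smult c (\<Prod>j<N. [:- \<zeta> j, 1:])) = (\<Sum>j<N. {#\<zeta> j#})"
  using assms by (subst proots_smult) (auto simp: proots_prod)

lemma sum_mset_image_sum_singletons: "(\<Sum>x\<in>#(\<Sum>j<N. {#g j#}). h x) = (\<Sum>j<(N::nat). h (g j))"
  by (induction N) (simp_all add: add.commute)

text \<open>All critical points are 0 and \<open>cmod a = 1\<close>, so every term is 1.\<close>

lemma crit_recip_sum_binomial:
  assumes "c \<noteq> 0" "1 \<le> n" "cmod \<omega> = 1" "p = smult c (monom 1 n - [:\<omega>:])" "poly p a = 0"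
  shows "crit_recip_sum s p a = of_nat (n - 1)"
proof -
  have "a ^ n = \<omega>" using assms by (simp add: poly_monom)
  then have "cmod a ^ n = 1" using assms(3) by (simp flip: norm_power)
  then have a: "cmod a = 1" using assms(2) power_eq_imp_eq_base[of "cmod a" n 1] by simp
  have "pderiv p = smult c (monom (of_nat n) (n - 1))"
    unfolding assms(4) by (simp add: pderiv_smult pderiv_diff pderiv_monom pderiv_pCons)
  also have "\<dots> = smult (c * of_nat n) ([:- 0, 1:] ^ (n - 1))" by (simp add: monom_altdef)
  finally have "pderiv p = smult (c * of_nat n) ([:- 0, 1:] ^ (n - 1))" .
  then have "proots (pderiv p) = repeat_mset (n - 1) {#0#}"
    using assms by (simp add: proots_power del: minus_zero)
  then show ?thesis using a unfolding crit_recip_sum_def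
    by (simp add: recip_dist_powr_def)
qed

theorem corollary1p4:
  fixes p :: "complex poly" and n :: nat and a :: complex and s :: real
  assumes "degree p = n" and "n \<ge> 2"
    and "\<And>z. poly p z = 0 \<Longrightarrow> cmod z \<le> 1"
    and "poly p a = 0"
    and "s \<ge> 2"
  shows "crit_recip_sum s p a \<ge> of_nat (n - 1) \<and>
    (crit_recip_sum s p a = of_nat (n - 1) \<longleftrightarrow>
      (\<exists>c \<omega>. c \<noteq> 0 \<and> cmod \<omega> = 1 \<and> p = smult c (monom 1 n - [:\<omega>:])))"
proof -
  define N where "N = n - 1"
  have N: "0 < N" "n = N + 1" unfolding N_def using assms(2) by auto
  have p0: "p \<noteq> 0" using assms(1,2) by auto
  obtain q where q: "p = [:-a, 1:] * q" using assms(4) by (auto simp: poly_eq_0_iff_dvd)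
  have q0: "q \<noteq> 0" using p0 q by auto
  have "degree p = degree [:-a, 1:] + degree q" unfolding q by (rule degree_mult_eq) (use q0 in auto)
  then have degq: "degree q = N" using assms(1) N(2) by simp
  define c where "c = lead_coeff p"
  have c: "c \<noteq> 0" "lead_coeff q = c"
    using p0 lead_coeff_mult[of "[:-a, 1:]" q] unfolding c_def q[symmetric] by auto
  obtain z where "smult (lead_coeff q) (\<Prod>k<degree q. [:- z k, 1:]) = q"
    by (rule complex_poly_decompose')
  then have z: "q = smult c (\<Prod>k<N. [:- z k, 1:])" unfolding c(2) unfolding degq by (rule sym)
  have degd: "degree (pderiv p) = N" by (simp only: degree_pderiv assms(1) N_def)
  have lcd: "lead_coeff (pderiv p) = of_nat n * c"
    unfolding degd using N assms(1) by (simp add: coeff_pderiv c_def)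
  obtain \<zeta> where "smult (lead_coeff (pderiv p)) (\<Prod>j<degree (pderiv p). [:- \<zeta> j, 1:]) = pderiv p"
    by (rule complex_poly_decompose')
  then have \<zeta>: "pderiv p = smult (of_nat n * c) (\<Prod>j<N. [:- \<zeta> j, 1:])" unfolding lcd unfolding degd by (rule sym)
  \<comment> \<open>The product rule for \<open>p\<close>, with the leading coefficient cancelled;
    the \<open>z k\<close> are the zeros left after splitting off one copy of
    \<open>a\<close>.\<close>
  have id: "of_nat (N + 1) * (\<Prod>j<N. t - \<zeta> j) =
      (\<Prod>k<N. t - z k) + (t - a) * (\<Sum>k<N. \<Prod>i\<in>{..<N}-{k}. t - z i)" for t
  proof -
    have "pderiv p = q + [:-a, 1:] * smult c (\<Sum>k<N. \<Prod>i\<in>{..<N}-{k}. [:- z i, 1:])"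
      unfolding q by (subst pderiv_mult) (simp add: z pderiv_smult pderiv_prod pderiv_pCons)
    then have "poly (pderiv p) t = c * ((\<Prod>k<N. t - z k) + (t - a) * (\<Sum>k<N. \<Prod>i\<in>{..<N}-{k}. t - z i))"
      unfolding z by (simp add: poly_prod poly_sum algebra_simps)
    moreover have "poly (pderiv p) t = c * (of_nat (N + 1) * (\<Prod>j<N. t - \<zeta> j))"
      unfolding \<zeta> N(2) by (simp add: poly_prod)
    ultimately show ?thesis using c by simp
  qed
  have a1: "cmod a \<le> 1" using assms(3,4) by blast
  have z1: "cmod (z k) \<le> 1" if "k < N" for k
  proof (rule assms(3))
    show "poly p (z k) = 0" unfolding q z using that by (auto simp: poly_prod)
  qed
  have sum_eq: "crit_recip_sum s p a = (\<Sum>j<N. recip_dist_powr s a (\<zeta> j))"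
    unfolding crit_recip_sum_def \<zeta> using c N
    by (subst proots_prod_linear) (auto simp: sum_mset_image_sum_singletons simp del: of_nat_Suc of_nat_add)
  have conv: "crit_recip_sum s p a = of_nat (n - 1)"
    if "\<exists>c \<omega>. c \<noteq> 0 \<and> cmod \<omega> = 1 \<and> p = smult c (monom 1 n - [:\<omega>:])"
    using that crit_recip_sum_binomial[of _ n _ p a s] assms(2,4) by auto
  show ?thesis
  proof (cases "\<exists>j<N. \<zeta> j = a")
    case True
    then obtain j where j: "j < N" "\<zeta> j = a" by blast
    \<comment> \<open>The bound is then trivial, and the binomial form is excluded because
      \<open>conv\<close> would make the sum finite.\<close>
    have "crit_recip_sum s p a = \<infinity>"
      unfolding sum_eq using j sum.remove[of "{..<N}" j "\<lambda>j. recip_dist_powr s a (\<zeta> j)"]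
      by (simp add: recip_dist_powr_self)
    then show ?thesis using conv by auto
  next
    case False
    then have \<zeta>a: "\<zeta> j \<noteq> a" if "j < N" for j using that by blast
    note main = recip_distance_powers[OF N(1) id \<zeta>a z1 a1 assms(5)]
    have "crit_recip_sum s p a = (\<Sum>j<N. ennreal (1 / cmod (a - \<zeta> j) powr s))"
      unfolding sum_eq by (intro sum.cong refl recip_dist_powr_neq) (metis \<zeta>a lessThan_iff)
    also have "\<dots> = ennreal (\<Sum>j<N. 1 / cmod (a - \<zeta> j) powr s)" by (intro sum_ennreal) auto
    finally have eq: "crit_recip_sum s p a = ennreal (\<Sum>j<N. 1 / cmod (a - \<zeta> j) powr s)" .
    have "of_nat (n - 1) \<le> crit_recip_sum s p a"
      unfolding eq N_def[symmetric] ennreal_of_nat_eq_real_of_nat using main(1) by (intro ennreal_leI) auto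
    moreover have "\<exists>c \<omega>. c \<noteq> 0 \<and> cmod \<omega> = 1 \<and> p = smult c (monom 1 n - [:\<omega>:])"
      if "crit_recip_sum s p a = of_nat (n - 1)"
    proof -
      have "(\<Sum>j<N. 1 / cmod (a - \<zeta> j) powr s) = N"
        using that unfolding eq N_def[symmetric] ennreal_of_nat_eq_real_of_nat
        by (subst (asm) ennreal_inj) (auto intro!: sum_nonneg)
      then have a1: "cmod a = 1" and \<zeta>0: "\<forall>j<N. \<zeta> j = 0" using main(2) by auto
      \<comment> \<open>With all critical points 0, \<open>p\<close> and
        \<open>smult c (monom 1 n)\<close> have the same derivative; their constant difference
        \<open>d\<close> gives \<omega> = \<open>- d / c\<close>, of modulus
        \<open>cmod (a ^ n) = 1\<close>.\<close>
      have "pderiv (smult c (monom 1 n)) = smult c (monom (of_nat n) N)"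
        unfolding N(2) by (simp add: pderiv_smult pderiv_monom)
      also have "\<dots> = smult (of_nat n * c) ([:0, 1:] ^ N)" by (simp add: monom_altdef mult.commute)
      also have "\<dots> = pderiv p" unfolding \<zeta> using \<zeta>0 by simp
      finally have "pderiv (p - smult c (monom 1 n)) = 0" by (simp add: pderiv_diff)
      then obtain d where d: "p - smult c (monom 1 n) = [:d:]" by (auto simp: pderiv_eq_0_iff elim: degree_eq_zeroE)
      then have p: "p = smult c (monom 1 n - [:- d / c:])" using c by (simp add: smult_diff_right algebra_simps)
      have "poly p a = c * (a ^ n - - d / c)" by (subst p) (simp add: poly_monom)
      then have "a ^ n = - d / c" using assms(4) c(1) by (simp add: add_eq_0_iff2)
      then have "cmod (- d / c) = cmod (a ^ n)" by (simp only:)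
      also have "\<dots> = 1" by (simp only: norm_power a1 power_one)
      finally have "cmod (- d / c) = 1" .
      then show ?thesis using p c by blast
    qed
    ultimately show ?thesis using conv by blast
  qed
qed

end
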